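(* Consider the control system for $w(x,t)$, $x\in[0,l]$, $t\ge0$, with the single scalar input $u_0$ and the single scalar output $y_1$ (the case $k=0$ of no piezo actuators and $p=1$ of one sensor), given by $$\ddot w(x,t)+\frac{EI}{\rho}w''''(x,t)+d\,\dot w''''(x,t)=0,\qquad x\in[0,l_0)\cup(l_0,l],$$ $$(m\ddot w+\varkappa w)\big|_{x=l_0}=(EIw'')'\big|_{x=l_0-0}-(EIw'')'\big|_{x=l_0+0}+u_0(t),$$ $$w|_{x=0}=w|_{x=l}=0,\qquad w''|_{x=0}=w''|_{x=l}=0,$$ $$y_1(t)=\frac{\partial^2w(x,t)}{\partial x^2}\Big|_{x=l_1},$$ with $w(\cdot,t)$ of class $C^2[0,l]$ and zero initial data, and assume $l_1\le l_0$. Then its transfer function, i.e. the scalar function $H(s)$ with $Y_1(s)=H(s)U_0(s)$, is $$H(s)=\frac1{EI}\left(-4\gamma^4z_4(l_1)\,M^{-1}_{14}+z_2(l_1)\,M^{-1}_{24}\right),$$ where $M^{-1}_{ij}$ denotes the $(i,j)$ entry of the inverse $M^{-1}$ of the $4\times4$ matrix $M$, and $\gamma$, $z_i$, $M$ are as defined in the context.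
   Context: Constants: $l>0$ (beam length), $l_0\in(0,l)$ (point of attachment of the mass-spring shaker), $l_1\in[0,l]$ (sensor location), $E,I,\rho,m,\varkappa>0$ and $d\ge0$ are constants (Young's modulus, area moment of inertia, mass per unit length, shaker mass, spring stiffness, structural damping). Dots denote time derivatives, primes denote derivatives in $x$. Transfer function: $U_0(s)=\int_0^\infty u_0(t)e^{-st}dt$, $Y_1(s)=\int_0^\infty y_1(t)e^{-st}dt$, and $W_1^s(x)=\int_0^\infty w(x,t)e^{-st}dt$. With zero initial data ($w=\dot w=0$ at $t=0$), the Laplace transform turns the system into a boundary value problem with parameter $s$: $(EI+\rho ds)\,(W_1^s)''''(x)+\rho s^2W_1^s(x)=0$ on $[0,l_0)$ and $(l_0,l]$; $W_1^s$ is of class $C^2[0,l]$; $W_1^s=(W_1^s)''=0$ at $x=0$ and $x=l$; $(ms^2+\varkappa)W_1^s(l_0)=EI(W_1^s)'''(l_0-0)-EI(W_1^s)'''(l_0+0)+U_0(s)$; and $Y_1(s)=(W_1^s)''(l_1)$. The transfer function is the coefficient $H(s)$ of the linear map $U_0\mapsto Y_1$ so determined. Here $s$ is a complex parameter with $s\neq0$, $EI+\rho ds\ne0$ and $M$ (below) invertible. Notation: $\alpha$ is such that $\alpha^4=\dfrac{\rho}{EI+\rho ds}$, $\gamma=\dfrac{\alpha\sqrt{2s}}{2}$ (so $4\gamma^4=\alpha^4s^2$; the functions $z_i$ below depend only on $\gamma^4$, so the choice of roots is immaterial), $\beta=\dfrac{s^2m+\varkappa}{EI}$, and $$z_1(x)=\cosh(\gamma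 x)\cos(\gamma x),\quad z_2(x)=\frac{\cosh(\gamma x)\sin(\gamma x)+\sinh(\gamma x)\cos(\gamma x)}{2\gamma},$$ $$z_3(x)=\frac{\sinh(\gamma x)\sin(\gamma x)}{2\gamma^2},\quad z_4(x)=\frac{\cosh(\gamma x)\sin(\gamma x)-\sinh(\gamma x)\cos(\gamma x)}{4\gamma^3}.$$ $$M=\begin{pmatrix}-z_2(l_0)&-z_4(l_0)&z_2(l_0-l)&z_4(l_0-l)\\-z_1(l_0)&-z_3(l_0)&z_1(l_0-l)&z_3(l_0-l)\\4\gamma^4z_4(l_0)&-z_2(l_0)&-4\gamma^4z_4(l_0-l)&z_2(l_0-l)\\\beta z_2(l_0)+4\gamma^4z_3(l_0)&\beta z_4(l_0)-z_1(l_0)&-4\gamma^4z_3(l_0-l)&z_1(l_0-l)\end{pmatrix}.$$ *)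

theory Defs
  imports "HOL-Analysis.Analysis"
begin

section \<open>Derivatives on the beam and on the time axis\<close>

text \<open>One-sided at the end points of \<open>[0,l]\<close> and at \<open>t = 0\<close>.\<close>

definition deriv_x :: "real \<Rightarrow> (real \<Rightarrow> 'a::real_normed_vector) \<Rightarrow> real \<Rightarrow> 'a" where
  "deriv_x l f x = vector_derivative f (at x within {0..l})"

definition deriv_t :: "(real \<Rightarrow> 'a::real_normed_vector) \<Rightarrow> real \<Rightarrow> 'a" where
  "deriv_t f t = vector_derivative f (at t within {0..})"

definition differentiable_x :: "real \<Rightarrow> nat \<Rightarrow> real set \<Rightarrow> (real \<Rightarrow> 'a::real_normed_vector) \<Rightarrow> bool" where
  "differentiable_x l n S f \<longleftrightarrow>
     (\<forall>k<n. \<forall>x\<in>S. (deriv_x l ^^ k) f differentiable (at x within {0..l}))"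

text \<open>
  Profiles that are \<open>C\<^sup>2\<close> on \<open>[0,l]\<close> and four times differentiable away from the attachment
  point \<open>l0\<close>. The functions \<open>(deriv_x l ^^ 3) f\<close> and \<open>(deriv_x l ^^ 4) f\<close> carry no information
  at \<open>l0\<close> itself and are never evaluated there.
\<close>

definition beam_profile :: "real \<Rightarrow> real \<Rightarrow> (real \<Rightarrow> 'a::real_normed_vector) \<Rightarrow> bool" where
  "beam_profile l l0 f \<longleftrightarrow>
     differentiable_x l 2 {0..l} f \<and>
     continuous_on {0..l} ((deriv_x l ^^ 2) f) \<and>
     differentiable_x l 4 ({0..l} - {l0}) f"

text \<open>Hinged ends.\<close>

definition hinged :: "real \<Rightarrow> (real \<Rightarrow> 'a::real_normed_vector) \<Rightarrow> bool" where
  "hinged l f \<longleftrightarrow> f 0 = 0 \<and> f l = 0 \<and> (deriv_x l ^^ 2) f 0 = 0 \<and> (deriv_x l ^^ 2) f l = 0"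

section \<open>The control system\<close>

text \<open>\<open>w x t\<close> is the deflection and \<open>u0\<close> the shaker force; the initial data are zero.\<close>

definition beam_trajectory ::
  "real \<Rightarrow> real \<Rightarrow> real \<Rightarrow> real \<Rightarrow> real \<Rightarrow> real \<Rightarrow> real \<Rightarrow> real \<Rightarrow> (real \<Rightarrow> real) \<Rightarrow> (real \<Rightarrow> real \<Rightarrow> real) \<Rightarrow> bool"
where
  "beam_trajectory l l0 E I \<rho> m \<kappa> d u0 w \<longleftrightarrow>
     (\<forall>t\<ge>0. beam_profile l l0 (\<lambda>x. w x t) \<and>
            differentiable_x l 4 ({0..l} - {l0}) (\<lambda>x. deriv_t (w x) t)) \<and>
     (\<forall>x\<in>{0..l}. \<forall>t\<ge>0. w x differentiable (at t within {0..}) \<and>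
            deriv_t (w x) differentiable (at t within {0..})) \<and>
     (\<forall>x\<in>{0..l} - {l0}. \<forall>t\<ge>0.
        (deriv_t ^^ 2) (w x) t + E * I / \<rho> * (deriv_x l ^^ 4) (\<lambda>x. w x t) x
          + d * (deriv_x l ^^ 4) (\<lambda>x. deriv_t (w x) t) x = 0) \<and>
     (\<forall>t\<ge>0. \<exists>a b.
        ((deriv_x l ^^ 3) (\<lambda>x. w x t) \<longlongrightarrow> a) (at_left l0) \<and>
        ((deriv_x l ^^ 3) (\<lambda>x. w x t) \<longlongrightarrow> b) (at_right l0) \<and>
        m * (deriv_t ^^ 2) (w l0) t + \<kappa> * w l0 t = E * I * a - E * I * b + u0 t) \<and>
     (\<forall>t\<ge>0. hinged l (\<lambda>x. w x t)) \<and>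
     (\<forall>x\<in>{0..l}. w x 0 = 0 \<and> deriv_t (w x) 0 = 0)"

text \<open>The sensor at \<open>l1\<close>.\<close>

definition sensor_output :: "real \<Rightarrow> real \<Rightarrow> (real \<Rightarrow> real \<Rightarrow> real) \<Rightarrow> real \<Rightarrow> real" where
  "sensor_output l l1 w t = (deriv_x l ^^ 2) (\<lambda>x. w x t) l1"

section \<open>Laplace transform and transfer function\<close>

definition has_laplace :: "(real \<Rightarrow> real) \<Rightarrow> complex \<Rightarrow> complex \<Rightarrow> bool" where
  "has_laplace f s F \<longleftrightarrow> ((\<lambda>t. complex_of_real (f t) * exp (- s * complex_of_real t)) has_integral F) {0..}"

text \<open>
  Trajectories to which the transform may be applied at \<open>s\<close>: all derivatives appearing in the
  system are of a common exponential order below \<open>Re s\<close>, uniformly along the beam.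
\<close>

definition exponential_order_below ::
  "real \<Rightarrow> real \<Rightarrow> complex \<Rightarrow> (real \<Rightarrow> real \<Rightarrow> real) \<Rightarrow> bool"
where
  "exponential_order_below l l0 s w \<longleftrightarrow>
     (\<exists>C \<sigma>. \<sigma> < Re s \<and>
       (\<forall>t\<ge>0.
         (\<forall>x\<in>{0..l}. \<forall>j\<le>2. \<bar>(deriv_t ^^ j) (w x) t\<bar> \<le> C * exp (\<sigma> * t)) \<and>
         (\<forall>x\<in>{0..l} - {l0}. \<forall>k\<le>4.
            \<bar>(deriv_x l ^^ k) (\<lambda>x. w x t) x\<bar> \<le> C * exp (\<sigma> * t) \<and>
            \<bar>(deriv_x l ^^ k) (\<lambda>x. deriv_t (w x) t) x\<bar> \<le> C * exp (\<sigma> * t))))"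

text \<open>The boundary value problem with parameter \<open>s\<close> for the transformed deflection \<open>W\<close>.\<close>

definition transformed_problem ::
  "real \<Rightarrow> real \<Rightarrow> real \<Rightarrow> real \<Rightarrow> real \<Rightarrow> real \<Rightarrow> real \<Rightarrow> real \<Rightarrow> complex \<Rightarrow> complex \<Rightarrow> (real \<Rightarrow> complex) \<Rightarrow> bool"
where
  "transformed_problem l l0 E I \<rho> m \<kappa> d s U W \<longleftrightarrow>
     beam_profile l l0 W \<and>
     (\<forall>x\<in>{0..l} - {l0}.
        (of_real (E * I) + of_real (\<rho> * d) * s) * (deriv_x l ^^ 4) W x + of_real \<rho> * s^2 * W x = 0) \<and>
     hinged l W \<and>
     (\<exists>a b.
        ((deriv_x l ^^ 3) W \<longlongrightarrow> a) (at_left l0) \<and>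
        ((deriv_x l ^^ 3) W \<longlongrightarrow> b) (at_right l0) \<and>
        (of_real m * s^2 + of_real \<kappa>) * W l0 = of_real (E * I) * a - of_real (E * I) * b + U)"

text \<open>
  \<open>h\<close> is the value at \<open>s\<close> of the transfer function: the transformed problem determines a map
  from \<open>U\<close> to \<open>W''(l1)\<close> and this map is multiplication by \<open>h\<close>; moreover the transforms of input
  and output along every trajectory transformable at \<open>s\<close> exist and are related by \<open>h\<close>. The first
  two clauses determine \<open>h\<close> uniquely (take \<open>U = 1\<close>), also for \<open>s\<close> outside the region of
  convergence of the Laplace integrals.
\<close>

definition is_transfer_function_at ::
  "real \<Rightarrow> real \<Rightarrow> real \<Rightarrow> real \<Rightarrow> real \<Rightarrow> real \<Rightarrow> real \<Rightarrow> real \<Rightarrow> real \<Rightarrow> complex \<Rightarrow> complex \<Rightarrow> bool"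
where
  "is_transfer_function_at l l0 l1 E I \<rho> m \<kappa> d s h \<longleftrightarrow>
     (\<forall>U. \<exists>W. transformed_problem l l0 E I \<rho> m \<kappa> d s U W) \<and>
     (\<forall>U W. transformed_problem l l0 E I \<rho> m \<kappa> d s U W \<longrightarrow> (deriv_x l ^^ 2) W l1 = h * U) \<and>
     (\<forall>u0 w. beam_trajectory l l0 E I \<rho> m \<kappa> d u0 w \<and> exponential_order_below l l0 s w \<longrightarrow>
        (\<exists>U Y. has_laplace u0 s U \<and> has_laplace (sensor_output l l1 w) s Y \<and> Y = h * U))"

section \<open>The fundamental system and the matrix\<close>

definition z1 :: "complex \<Rightarrow> real \<Rightarrow> complex" where
  "z1 \<gamma> x = cosh (\<gamma> * of_real x) * cos (\<gamma> * of_real x)"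

definition z2 :: "complex \<Rightarrow> real \<Rightarrow> complex" where
  "z2 \<gamma> x = (cosh (\<gamma> * of_real x) * sin (\<gamma> * of_real x) + sinh (\<gamma> * of_real x) * cos (\<gamma> * of_real x)) / (2 * \<gamma>)"

definition z3 :: "complex \<Rightarrow> real \<Rightarrow> complex" where
  "z3 \<gamma> x = sinh (\<gamma> * of_real x) * sin (\<gamma> * of_real x) / (2 * \<gamma>^2)"

definition z4 :: "complex \<Rightarrow> real \<Rightarrow> complex" where
  "z4 \<gamma> x = (cosh (\<gamma> * of_real x) * sin (\<gamma> * of_real x) - sinh (\<gamma> * of_real x) * cos (\<gamma> * of_real x)) / (4 * \<gamma>^3)"

definition shaker_matrix :: "real \<Rightarrow> real \<Rightarrow> complex \<Rightarrow> complex \<Rightarrow> complex^4^4" where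
  "shaker_matrix l l0 \<gamma> \<beta> = vector
    [vector [- z2 \<gamma> l0, - z4 \<gamma> l0, z2 \<gamma> (l0 - l), z4 \<gamma> (l0 - l)],
     vector [- z1 \<gamma> l0, - z3 \<gamma> l0, z1 \<gamma> (l0 - l), z3 \<gamma> (l0 - l)],
     vector [4 * \<gamma>^4 * z4 \<gamma> l0, - z2 \<gamma> l0, - 4 * \<gamma>^4 * z4 \<gamma> (l0 - l), z2 \<gamma> (l0 - l)],
     vector [\<beta> * z2 \<gamma> l0 + 4 * \<gamma>^4 * z3 \<gamma> l0, \<beta> * z4 \<gamma> l0 - z1 \<gamma> l0,
             - 4 * \<gamma>^4 * z3 \<gamma> (l0 - l), z1 \<gamma> (l0 - l)]]"

end

theory Submission
  imports Defs
begin

text \<open>On either side of the attachment point the transformed deflection solves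
  \<open>W'''' = - 4 \<gamma>\<^sup>4 W\<close>, so the hinges force \<open>W = A z\<^sub>2(x) + B z\<^sub>4(x)\<close> on the left and
  \<open>W = C z\<^sub>2(x - l) + D z\<^sub>4(x - l)\<close> on the right. Continuity of \<open>W\<close>, \<open>W'\<close>, \<open>W''\<close> and the force
  balance at \<open>l0\<close> amount to \<open>M (A, B, C, D)\<^sup>T = (0, 0, 0, U / EI)\<^sup>T\<close>, and
  \<open>W''(l1) = - 4 \<gamma>\<^sup>4 A z\<^sub>4(l1) + B z\<^sub>2(l1)\<close>.

  A trajectory of exponential order is transformed by differentiating its Laplace integral in \<open>x\<close>.
  No joint regularity and no measurability in \<open>t\<close> of the \<open>x\<close>-derivatives is assumed, but these are
  pointwise limits of difference quotients, whose integrability passes to the limit by dominated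
  convergence for the Henstock--Kurzweil integral.\<close>

section \<open>Dominated convergence and the Laplace transform\<close>

text \<open>Puts the derivative in the form to which dominated convergence applies. Being a limit,
  it also glues over a union of two sets.\<close>

lemma has_vector_derivative_iff_quotient:
  "(f has_vector_derivative D) (at x within S) \<longleftrightarrow>
     ((\<lambda>y. (f y - f x) /\<^sub>R (y - x)) \<longlongrightarrow> D) (at x within S)"
proof -
  have "norm ((f y - f x) - (y - x) *\<^sub>R D) / norm (y - x) = norm ((f y - f x) /\<^sub>R (y - x) - D)"
    if "y \<noteq> x" for y
  proof -
    have "(f y - f x) /\<^sub>R (y - x) - D = ((f y - f x) - (y - x) *\<^sub>R D) /\<^sub>R (y - x)"
      using that by (simp add: scaleR_diff_right)
    then show ?thesis
      by (simp add: divide_inverse_commute)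
  qed
  then have "((\<lambda>y. norm ((f y - f x) - (y - x) *\<^sub>R D) / norm (y - x)) \<longlongrightarrow> 0) (at x within S) \<longleftrightarrow>
        ((\<lambda>y. norm ((f y - f x) /\<^sub>R (y - x) - D)) \<longlongrightarrow> 0) (at x within S)"
    by (intro Lim_cong_within) auto
  also have "\<dots> \<longleftrightarrow> ((\<lambda>y. (f y - f x) /\<^sub>R (y - x)) \<longlongrightarrow> D) (at x within S)"
    by (simp only: tendsto_norm_zero_iff LIM_zero_iff)
  finally show ?thesis
    unfolding has_vector_derivative_def has_derivative_iff_norm
    by (simp add: bounded_linear_scaleR_left)
qed

text \<open>Dominated convergence works along sequences, and a limit at \<open>x\<close> within
  \<open>S\<close> is a limit along all sequences in \<open>S - {x}\<close> that tend to
  \<open>x\<close>. That \<open>x\<close> is a limit point supplies one such sequence, which gives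
  the integrability of \<open>g\<close>.\<close>

lemma tendsto_integral_dominated:
  fixes G :: "real \<Rightarrow> 'n::euclidean_space \<Rightarrow> 'm::euclidean_space"
  assumes lim: "x islimpt S"
    and int: "\<And>y. y \<in> S - {x} \<Longrightarrow> G y integrable_on T"
    and h: "h integrable_on T"
    and bound: "\<And>y t. y \<in> S - {x} \<Longrightarrow> t \<in> T \<Longrightarrow> norm (G y t) \<le> h t"
    and conv: "\<And>t. t \<in> T \<Longrightarrow> ((\<lambda>y. G y t) \<longlongrightarrow> g t) (at x within S)"
  shows "g integrable_on T"
    and "((\<lambda>y. integral T (G y)) \<longlongrightarrow> integral T g) (at x within S)"
proof -
  have seq: "g integrable_on T \<and> (\<lambda>i. integral T (G (X i))) \<longlonglongrightarrow> integral T g"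
    if X: "\<And>i. X i \<in> S - {x}" "X \<longlonglongrightarrow> x" for X :: "nat \<Rightarrow> real"
  proof -
    have "(\<lambda>i. G (X i) t) \<longlonglongrightarrow> g t" if "t \<in> T" for t
      using conv[OF that] X unfolding tendsto_at_iff_sequentially by (auto simp: o_def)
    then show ?thesis
      using dominated_convergence[of "\<lambda>i. G (X i)" T h g] int h bound X(1) by blast
  qed
  obtain X where "\<And>i. X i \<in> S - {x}" "X \<longlonglongrightarrow> x"
    using lim unfolding islimpt_sequential by blast
  then show "g integrable_on T"
    using seq by blast
  show "((\<lambda>y. integral T (G y)) \<longlongrightarrow> integral T g) (at x within S)"
    unfolding tendsto_at_iff_sequentially using seq by (auto simp: o_def)
qed

text \<open>The difference quotients are integrable, and by the mean value inequality on the convex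
  set \<open>S\<close> they are dominated by \<open>h\<close>. Integrability of \<open>G' x\<close>
  is therefore a conclusion, and this is what allows the differentiation to be repeated.\<close>

lemma has_vector_derivative_integral_dominated:
  fixes G G' :: "real \<Rightarrow> 'n::euclidean_space \<Rightarrow> 'm::euclidean_space"
  assumes "convex S" "x \<in> S" "x islimpt S"
    and int: "\<And>y. y \<in> S \<Longrightarrow> G y integrable_on T"
    and h: "h integrable_on T"
    and der: "\<And>y t. y \<in> S \<Longrightarrow> t \<in> T \<Longrightarrow> ((\<lambda>y. G y t) has_vector_derivative G' y t) (at y within S)"
    and bound: "\<And>y t. y \<in> S \<Longrightarrow> t \<in> T \<Longrightarrow> norm (G' y t) \<le> h t"
  shows "G' x integrable_on T"
    and "((\<lambda>y. integral T (G y)) has_vector_derivative integral T (G' x)) (at x within S)"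
proof -
  define Q where "Q y t = (G y t - G x t) /\<^sub>R (y - x)" for y t
  have int_Q: "Q y integrable_on T" "integral T (Q y) = (integral T (G y) - integral T (G x)) /\<^sub>R (y - x)"
    if "y \<in> S" for y
    using int[OF that] int[OF \<open>x \<in> S\<close>]
    by (auto simp: Q_def[abs_def] integral_diff intro!: integrable_cmul integrable_diff)
  have bound_Q: "norm (Q y t) \<le> h t" if "y \<in> S - {x}" "t \<in> T" for y t
  proof -
    have "norm (G y t - G x t) \<le> h t * norm (y - x)"
      by (rule differentiable_bound[OF \<open>convex S\<close>, where f' = "\<lambda>y k. k *\<^sub>R G' y t"])
        (use der bound that \<open>x \<in> S\<close> in \<open>auto simp: has_vector_derivative_def onorm_scaleR_left
          onorm_id bounded_linear_ident\<close>)
    then have "norm (G y t - G x t) / norm (y - x) \<le> h t"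
      using that by (simp add: pos_divide_le_eq)
    then show ?thesis
      by (simp only: Q_def norm_scaleR norm_inverse divide_inverse_commute real_norm_def abs_inverse)
  qed
  have conv: "((\<lambda>y. Q y t) \<longlongrightarrow> G' x t) (at x within S)" if "t \<in> T" for t
    using der[OF \<open>x \<in> S\<close> that] unfolding has_vector_derivative_iff_quotient Q_def .
  note * = tendsto_integral_dominated[OF \<open>x islimpt S\<close> int_Q(1) h bound_Q conv]
  show "G' x integrable_on T"
    using * by blast
  have "((\<lambda>y. integral T (Q y)) \<longlongrightarrow> integral T (G' x)) (at x within S)"
    using * by blast
  then show "((\<lambda>y. integral T (G y)) has_vector_derivative integral T (G' x)) (at x within S)"
    unfolding has_vector_derivative_iff_quotient
    by (rule Lim_transform_within[where d = 1]) (auto simp: int_Q(2))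
qed

text \<open>The truncations of \<open>f\<close> to \<open>{0..real k}\<close>, extended by 0,
  converge pointwise to \<open>f\<close> and stay below \<open>h\<close>.\<close>

lemma integrable_on_halfline_dominated:
  fixes f :: "real \<Rightarrow> 'm::euclidean_space"
  assumes int: "\<And>k::nat. f integrable_on {0..real k}"
    and h: "h integrable_on {0..}"
    and bound: "\<And>t. t \<ge> 0 \<Longrightarrow> norm (f t) \<le> h t"
  shows "f integrable_on {0..}" and "(\<lambda>k. integral {0..real k} f) \<longlonglongrightarrow> integral {0..} f"
proof -
  define g where "g k t = (if t \<in> {0..real k} then f t else 0)" for k t
  have "(g k has_integral integral {0..real k} f) {0..}" for k
    unfolding g_def by (subst has_integral_restrict) (use int in auto)
  then have g: "g k integrable_on {0..}" "integral {0..} (g k) = integral {0..real k} f" for k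
    by blast+
  have "norm (g k t) \<le> h t" if "t \<in> {0..}" for k t
    using bound[of t] that by (auto simp: g_def intro: order_trans[OF norm_ge_zero])
  moreover have "(\<lambda>k. g k t) \<longlonglongrightarrow> f t" if "t \<in> {0..}" for t
  proof -
    obtain N :: nat where "t \<le> real N"
      using real_arch_simple by blast
    then have "eventually (\<lambda>k. g k t = f t) sequentially"
      using that by (intro eventually_sequentiallyI[of N]) (auto simp: g_def)
    then show ?thesis
      by (rule tendsto_eventually)
  qed
  ultimately have "f integrable_on {0..}" "(\<lambda>k. integral {0..} (g k)) \<longlonglongrightarrow> integral {0..} f"
    using dominated_convergence[of g "{0..}" h f] g(1) h by blast+
  then show "f integrable_on {0..}" "(\<lambda>k. integral {0..real k} f) \<longlonglongrightarrow> integral {0..} f"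
    by (simp_all add: g(2))
qed

section \<open>Laplace integrals of functions of exponential order\<close>

definition laplace_integrand :: "complex \<Rightarrow> (real \<Rightarrow> real) \<Rightarrow> real \<Rightarrow> complex" where
  "laplace_integrand s f t = complex_of_real (f t) * exp (- s * complex_of_real t)"

text \<open>\<open>integral\<close> is total, with value 0 on a non-integrable function, so a value
  of \<open>laplace\<close> is informative only together with integrability. Statements with
  \<open>has_laplace\<close> carry both.\<close>

definition laplace :: "complex \<Rightarrow> (real \<Rightarrow> real) \<Rightarrow> complex" where
  "laplace s f = integral {0..} (laplace_integrand s f)"

lemma norm_laplace_integrand_le:
  assumes "\<bar>f t\<bar> \<le> C * exp (\<sigma> * t)"
  shows "norm (laplace_integrand s f t) \<le> C * exp (- (Re s - \<sigma>) * t)"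
proof -
  have "norm (laplace_integrand s f t) = \<bar>f t\<bar> * exp (- Re s * t)"
    by (simp add: laplace_integrand_def norm_mult)
  also have "\<dots> \<le> C * exp (\<sigma> * t) * exp (- Re s * t)"
    using assms by (intro mult_right_mono) auto
  also have "\<dots> = C * exp (- (Re s - \<sigma>) * t)"
    by (simp add: mult_exp_exp ring_distribs)
  finally show ?thesis .
qed

lemma integrable_exp_bound:
  assumes "\<sigma> < Re s"
  shows "(\<lambda>t. C * exp (- (Re s - \<sigma>) * t)) integrable_on {0..}"
  by (intro integrable_on_mult_right integrable_on_exp_minus_to_infinity) (use assms in simp)

lemma laplace_integrand_continuous_integrable:
  assumes "\<sigma> < Re s" "continuous_on {0..} f" "\<And>t. t \<ge> 0 \<Longrightarrow> \<bar>f t\<bar> \<le> C * exp (\<sigma> * t)"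
  shows "laplace_integrand s f integrable_on {0..}"
proof (rule integrable_on_halfline_dominated(1))
  show "(\<lambda>t. C * exp (- (Re s - \<sigma>) * t)) integrable_on {0..}"
    using integrable_exp_bound assms(1) .
  have "continuous_on {0..real k} f" for k
    using assms(2) continuous_on_subset by fastforce
  then show "laplace_integrand s f integrable_on {0..real k}" for k
    unfolding laplace_integrand_def[abs_def]
    by (intro integrable_continuous_interval continuous_intros)
  show "norm (laplace_integrand s f t) \<le> C * exp (- (Re s - \<sigma>) * t)" if "t \<ge> 0" for t
    using norm_laplace_integrand_le assms(3)[OF that] .
qed

text \<open>By the product rule \<open>?L' t - s * ?L t\<close> is the derivative of
  \<open>?L\<close>. The gauge integral integrates every derivative, so \<open>?L'\<close> is
  integrable on bounded intervals although \<open>deriv_t f\<close> need not be continuous. The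
  boundary term vanishes at 0 by \<open>f 0 = 0\<close> and at infinity by
  \<open>\<sigma> < Re s\<close>.\<close>

lemma laplace_deriv_t:
  assumes \<sigma>: "\<sigma> < Re s"
    and diff: "\<And>t. t \<ge> 0 \<Longrightarrow> f differentiable (at t within {0..})"
    and bound: "\<And>t. t \<ge> 0 \<Longrightarrow> \<bar>f t\<bar> \<le> C * exp (\<sigma> * t)" "\<And>t. t \<ge> 0 \<Longrightarrow> \<bar>deriv_t f t\<bar> \<le> C * exp (\<sigma> * t)"
    and "f 0 = 0"
  shows "laplace_integrand s (deriv_t f) integrable_on {0..}"
    and "laplace s (deriv_t f) = s * laplace s f"
proof -
  let ?L = "laplace_integrand s f" and ?L' = "laplace_integrand s (deriv_t f)"
  let ?h = "\<lambda>t. C * exp (- (Re s - \<sigma>) * t)"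
  have cont: "continuous_on {0..} f"
    using diff by (auto simp: continuous_on_eq_continuous_within intro: differentiable_imp_continuous_within)
  have der: "(?L has_vector_derivative ?L' t - s * ?L t) (at t within {0..real k})"
    if "t \<in> {0..real k}" for t k
  proof -
    have "(f has_vector_derivative deriv_t f t) (at t within {0..})"
      using diff[of t] that by (simp add: deriv_t_def flip: vector_derivative_works)
    then have "(f has_vector_derivative deriv_t f t) (at t within {0..real k})"
      by (rule has_vector_derivative_within_subset) auto
    then have "((\<lambda>t. complex_of_real (f t)) has_vector_derivative of_real (deriv_t f t)) (at t within {0..real k})"
      by (rule bounded_linear.has_vector_derivative[OF bounded_linear_of_real])
    moreover have "((\<lambda>t. exp (- s * complex_of_real t)) has_vector_derivative
        - s * exp (- s * complex_of_real t)) (at t within {0..real k})"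
      by (rule has_vector_derivative_real_field derivative_eq_intros refl | simp)+
    ultimately have "((\<lambda>t. of_real (f t) * exp (- s * complex_of_real t)) has_vector_derivative
        of_real (f t) * (- s * exp (- s * complex_of_real t)) + of_real (deriv_t f t) * exp (- s * complex_of_real t))
        (at t within {0..real k})"
      by (rule has_vector_derivative_mult)
    then show ?thesis
      unfolding laplace_integrand_def[abs_def] by (simp add: algebra_simps)
  qed
  have intL: "?L integrable_on {0..}"
    using laplace_integrand_continuous_integrable \<sigma> cont bound(1) .
  have intLk: "?L integrable_on {0..real k}" for k
    using intL by (rule integrable_on_subinterval) auto
  have ftc: "((\<lambda>t. ?L' t - s * ?L t) has_integral ?L (real k)) {0..real k}" for k
    using fundamental_theorem_of_calculus[OF _ der, of k] \<open>f 0 = 0\<close>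
    by (simp add: laplace_integrand_def)
  \<comment> \<open>The fundamental theorem covers only the combination; adding back the integrable
    function \<open>s * ?L t\<close> isolates \<open>?L'\<close>.\<close>
  have "((\<lambda>t. (?L' t - s * ?L t) + s * ?L t) has_integral ?L (real k) + s * integral {0..real k} ?L) {0..real k}" for k
    by (intro has_integral_add ftc has_integral_mult_right integrable_integral intLk)
  then have L'k: "(?L' has_integral ?L (real k) + s * integral {0..real k} ?L) {0..real k}" for k
    by simp
  have norm_le: "norm (?L t) \<le> ?h t" "norm (?L' t) \<le> ?h t" if "t \<ge> 0" for t
    using bound[OF that] by (blast intro: norm_laplace_integrand_le)+
  have "?L' integrable_on {0..real k}" for k
    using L'k by blast
  note lim' = integrable_on_halfline_dominated[OF this integrable_exp_bound[OF \<sigma>] norm_le(2)]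
  note lim = integrable_on_halfline_dominated(2)[OF intLk integrable_exp_bound[OF \<sigma>] norm_le(1)]
  show "?L' integrable_on {0..}"
    using lim'(1) by simp
  have "filterlim (\<lambda>k. - (Re s - \<sigma>) * real k) at_bot sequentially"
    using \<sigma> by (intro filterlim_tendsto_neg_mult_at_bot[OF tendsto_const] filterlim_real_sequentially) simp
  then have "(\<lambda>k. ?h (real k)) \<longlonglongrightarrow> 0"
    by (intro tendsto_mult_right_zero filterlim_compose[OF exp_at_bot])
  then have "(\<lambda>k. ?L (real k)) \<longlonglongrightarrow> 0"
    by (rule Lim_null_comparison[rotated]) (use norm_le(1) in auto)
  then have "(\<lambda>k. ?L (real k) + s * integral {0..real k} ?L) \<longlonglongrightarrow> 0 + s * integral {0..} ?L"
    by (intro tendsto_intros lim) auto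
  moreover have "(\<lambda>k. ?L (real k) + s * integral {0..real k} ?L) \<longlonglongrightarrow> integral {0..} ?L'"
    using lim'(2) by (simp only: integral_unique[OF L'k])
  ultimately have "0 + s * integral {0..} ?L = integral {0..} ?L'"
    by (rule LIMSEQ_unique)
  then show "laplace s (deriv_t f) = s * laplace s f"
    by (simp add: laplace_def)
qed

lemma has_laplace_iff: "has_laplace f s F \<longleftrightarrow> (laplace_integrand s f has_integral F) {0..}"
  by (simp add: has_laplace_def laplace_integrand_def[abs_def])

lemma has_laplace_laplace:
  "laplace_integrand s f integrable_on {0..} \<Longrightarrow> has_laplace f s (laplace s f)"
  unfolding has_laplace_iff laplace_def by (rule integrable_integral)

lemma has_laplace_unique: "has_laplace f s F \<Longrightarrow> has_laplace f s G \<Longrightarrow> F = G"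
  unfolding has_laplace_iff by (rule has_integral_unique)

lemma has_laplace_eq:
  assumes "has_laplace f s F" "\<And>t. t \<ge> 0 \<Longrightarrow> f t = g t"
  shows "has_laplace g s F"
  using assms(1) unfolding has_laplace_iff
  by (rule has_integral_eq[rotated]) (simp add: laplace_integrand_def assms(2))

lemma has_laplace_add:
  assumes "has_laplace f s F" "has_laplace g s G"
  shows "has_laplace (\<lambda>t. f t + g t) s (F + G)"
  using has_integral_add[OF assms[unfolded has_laplace_def]]
  by (simp add: has_laplace_def algebra_simps)

lemma has_laplace_cmult:
  assumes "has_laplace f s F"
  shows "has_laplace (\<lambda>t. c * f t) s (of_real c * F)"
  using has_integral_mult_right[OF assms[unfolded has_laplace_def], of "of_real c"]
  by (simp add: has_laplace_def mult.assoc)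

lemma has_laplace_0: "has_laplace (\<lambda>t. 0) s 0"
  by (simp add: has_laplace_def)

section \<open>Hinged solutions and the boundary value problem\<close>

lemma at_within_openin:
  assumes "openin (top_of_set T) S" "x \<in> S"
  shows "at x within S = at x within T"
proof -
  obtain U where "open U" "S = T \<inter> U"
    using assms(1) by (auto simp: openin_open)
  then show ?thesis
    using \<open>x \<in> S\<close> by (intro at_within_nhd[of x U]) auto
qed

lemma has_vector_derivative_within_Un:
  assumes "(f has_vector_derivative D) (at x within S)" "(f has_vector_derivative D) (at x within T)"
  shows "(f has_vector_derivative D) (at x within S \<union> T)"
  using assms unfolding has_vector_derivative_iff_quotient by (simp add: Lim_within_Un)

lemma deriv_x_eqI:
  assumes "0 < l" "x \<in> {0..l}" "(f has_vector_derivative D) (at x within {0..l})"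
  shows "deriv_x l f x = D"
proof -
  have "x islimpt {0..l}"
    using assms by (simp add: islimpt_Icc)
  then show ?thesis
    unfolding deriv_x_def using assms(3)
    by (intro vector_derivative_within) (simp_all add: trivial_limit_within)
qed

lemma differentiable_x_has_vector_derivative:
  assumes "differentiable_x l n S f" "k < n" "x \<in> S"
  shows "((deriv_x l ^^ k) f has_vector_derivative (deriv_x l ^^ Suc k) f x) (at x within {0..l})"
  using assms by (simp add: differentiable_x_def deriv_x_def vector_derivative_works)

lemma differentiable_x_subset: "differentiable_x l n T f \<Longrightarrow> S \<subseteq> T \<Longrightarrow> differentiable_x l n S f"
  by (auto simp: differentiable_x_def)

text \<open>Relative openness makes \<open>at x within S\<close> and
  \<open>at x within {0..l}\<close> the same filter. Values of \<open>f\<close> outside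
  \<open>S\<close> thus do not affect derivatives in \<open>S\<close>, and agreement on
  \<open>S\<close> passes from order \<open>k\<close> to order \<open>k + 1\<close>.\<close>

lemma deriv_x_funpow_eq:
  assumes "0 < l" and S: "openin (top_of_set {0..l}) S"
    and F: "\<And>k x. k < n \<Longrightarrow> x \<in> S \<Longrightarrow> (F k has_vector_derivative F (Suc k) x) (at x within {0..l})"
    and f: "\<And>x. x \<in> S \<Longrightarrow> f x = F 0 x"
    and "k \<le> n" "x \<in> S"
  shows "(deriv_x l ^^ k) f x = F k x"
  using \<open>k \<le> n\<close> \<open>x \<in> S\<close>
proof (induction k arbitrary: x)
  case (Suc k)
  have "S \<subseteq> {0..l}"
    using S openin_imp_subset by blast
  note at_S = at_within_openin[OF S \<open>x \<in> S\<close>]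
  have "(F k has_vector_derivative F (Suc k) x) (at x within S)"
    using F[of k x] Suc.prems by (simp add: at_S)
  then have "((deriv_x l ^^ k) f has_vector_derivative F (Suc k) x) (at x within S)"
    using Suc by (elim has_vector_derivative_weaken) auto
  then show ?case
    using \<open>0 < l\<close> \<open>S \<subseteq> {0..l}\<close> Suc.prems by (auto intro!: deriv_x_eqI simp: at_S)
qed (use f in simp)

lemma differentiable_xI:
  assumes "0 < l" and S: "openin (top_of_set {0..l}) S"
    and F: "\<And>k x. k < n \<Longrightarrow> x \<in> S \<Longrightarrow> (F k has_vector_derivative F (Suc k) x) (at x within {0..l})"
    and f: "\<And>x. x \<in> S \<Longrightarrow> f x = F 0 x"
  shows "differentiable_x l n S f"
  unfolding differentiable_x_def
proof (intro allI impI ballI)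
  fix k x assume "k < n" "x \<in> S"
  have "(F k has_vector_derivative F (Suc k) x) (at x within S)"
    using F[of k x] \<open>k < n\<close> \<open>x \<in> S\<close> by (simp add: at_within_openin[OF S])
  then have "((deriv_x l ^^ k) f has_vector_derivative F (Suc k) x) (at x within S)"
    using deriv_x_funpow_eq[OF assms] \<open>k < n\<close> \<open>x \<in> S\<close>
    by (elim has_vector_derivative_weaken) auto
  then show "(deriv_x l ^^ k) f differentiable (at x within {0..l})"
    using \<open>x \<in> S\<close> by (auto simp: at_within_openin[OF S] intro: differentiableI_vector)
qed

text \<open>The half-open pieces include their end of the beam and are still relatively open, so
  one-sided derivatives at the hinges are handled like interior ones.\<close>

lemma openin_Icc_pieces:
  fixes l l0 :: real
  shows "openin (top_of_set {0..l}) {0..l}"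
    and "openin (top_of_set {0..l}) ({0..l} - {l0})"
    and "l0 < l \<Longrightarrow> openin (top_of_set {0..l}) {0..<l0}"
    and "0 < l0 \<Longrightarrow> openin (top_of_set {0..l}) {l0<..l}"
proof -
  show "openin (top_of_set {0..l}) {0..l}"
    by simp
  show "openin (top_of_set {0..l}) ({0..l} - {l0})"
    by (auto simp: openin_open intro!: exI[of _ "- {l0}"])
  show "openin (top_of_set {0..l}) {0..<l0}" if "l0 < l"
    using that by (auto simp: openin_open intro!: exI[of _ "{..<l0}"])
  show "openin (top_of_set {0..l}) {l0<..l}" if "0 < l0"
    using that by (auto simp: openin_open intro!: exI[of _ "{l0<..}"])
qed

section \<open>The fundamental system and hinged solutions\<close>

lemma z_at_0 [simp]: "z1 \<gamma> 0 = 1" "z2 \<gamma> 0 = 0" "z3 \<gamma> 0 = 0" "z4 \<gamma> 0 = 0"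
  by (simp_all add: z1_def z2_def z3_def z4_def)

text \<open>Differentiation runs through \<open>z4\<close>, \<open>z3\<close>, \<open>z2\<close>,
  \<open>z1\<close> and returns to \<open>z4\<close> with the factor
  \<open>- 4 * \<gamma>^4\<close>. Since only \<open>z1\<close> is nonzero at 0, these are the
  solutions of the fourth-order equation with unit initial data.\<close>

lemma z_has_vector_derivative:
  assumes "\<gamma> \<noteq> 0"
  shows "(z1 \<gamma> has_vector_derivative - 4 * \<gamma>^4 * z4 \<gamma> x) (at x within S)"
    and "(z2 \<gamma> has_vector_derivative z1 \<gamma> x) (at x within S)"
    and "(z3 \<gamma> has_vector_derivative z2 \<gamma> x) (at x within S)"
    and "(z4 \<gamma> has_vector_derivative z3 \<gamma> x) (at x within S)"
  unfolding z1_def[abs_def] z2_def[abs_def] z3_def[abs_def] z4_def[abs_def]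
  by (rule has_vector_derivative_real_field derivative_eq_intros refl |
      (use assms in \<open>simp add: field_simps power2_eq_square power3_eq_cube power4_eq_xxxx; fail\<close>))+

lemma z_comp_has_vector_derivative:
  assumes "\<gamma> \<noteq> 0" "(g has_vector_derivative g') (at x within S)"
  shows "((\<lambda>x. z1 \<gamma> (g x)) has_vector_derivative g' *\<^sub>R (- 4 * \<gamma>^4 * z4 \<gamma> (g x))) (at x within S)"
    and "((\<lambda>x. z2 \<gamma> (g x)) has_vector_derivative g' *\<^sub>R z1 \<gamma> (g x)) (at x within S)"
    and "((\<lambda>x. z3 \<gamma> (g x)) has_vector_derivative g' *\<^sub>R z2 \<gamma> (g x)) (at x within S)"
    and "((\<lambda>x. z4 \<gamma> (g x)) has_vector_derivative g' *\<^sub>R z3 \<gamma> (g x)) (at x within S)"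
  by (rule vector_diff_chain_within[OF assms(2) z_has_vector_derivative(1)[OF assms(1)], unfolded o_def]
      vector_diff_chain_within[OF assms(2) z_has_vector_derivative(2)[OF assms(1)], unfolded o_def]
      vector_diff_chain_within[OF assms(2) z_has_vector_derivative(3)[OF assms(1)], unfolded o_def]
      vector_diff_chain_within[OF assms(2) z_has_vector_derivative(4)[OF assms(1)], unfolded o_def])+

text \<open>\<open>mode \<gamma> A B c k\<close> is the \<open>k\<close>-th derivative of the general solution of
  \<open>f'''' = - 4 \<gamma>\<^sup>4 f\<close> that is hinged at \<open>c\<close>.\<close>

fun mode :: "complex \<Rightarrow> complex \<Rightarrow> complex \<Rightarrow> real \<Rightarrow> nat \<Rightarrow> real \<Rightarrow> complex" where
  "mode \<gamma> A B c 0 x = A * z2 \<gamma> (x - c) + B * z4 \<gamma> (x - c)"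
| "mode \<gamma> A B c (Suc 0) x = A * z1 \<gamma> (x - c) + B * z3 \<gamma> (x - c)"
| "mode \<gamma> A B c (Suc (Suc 0)) x = - 4 * \<gamma>^4 * A * z4 \<gamma> (x - c) + B * z2 \<gamma> (x - c)"
| "mode \<gamma> A B c (Suc (Suc (Suc 0))) x = - 4 * \<gamma>^4 * A * z3 \<gamma> (x - c) + B * z1 \<gamma> (x - c)"
| "mode \<gamma> A B c (Suc (Suc (Suc (Suc k)))) x = - 4 * \<gamma>^4 * mode \<gamma> A B c k x"

lemma mode_has_vector_derivative:
  assumes "\<gamma> \<noteq> 0"
  shows "(mode \<gamma> A B c k has_vector_derivative mode \<gamma> A B c (Suc k) x) (at x within S)"
proof -
  have fun_eq: "mode \<gamma> A B c 0 = (\<lambda>x. A * z2 \<gamma> (x - c) + B * z4 \<gamma> (x - c))"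
    "mode \<gamma> A B c (Suc 0) = (\<lambda>x. A * z1 \<gamma> (x - c) + B * z3 \<gamma> (x - c))"
    "mode \<gamma> A B c (Suc (Suc 0)) = (\<lambda>x. - 4 * \<gamma>^4 * A * z4 \<gamma> (x - c) + B * z2 \<gamma> (x - c))"
    "mode \<gamma> A B c (Suc (Suc (Suc 0))) = (\<lambda>x. - 4 * \<gamma>^4 * A * z3 \<gamma> (x - c) + B * z1 \<gamma> (x - c))"
    "mode \<gamma> A B c (Suc (Suc (Suc (Suc k)))) = (\<lambda>x. - 4 * \<gamma>^4 * mode \<gamma> A B c k x)"
    for \<gamma> A B c k
    by (rule ext, simp)+
  have shift: "((\<lambda>x. x - c) has_vector_derivative 1) (at x within S)" for c x
    by (auto intro!: derivative_eq_intros)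
  note z = z_comp_has_vector_derivative[OF _ shift, simplified]
  show ?thesis
    using assms
  proof (induction \<gamma> A B c k x rule: mode.induct)
    case 1 then show ?case unfolding fun_eq by (auto intro!: derivative_eq_intros z)
  next
    case 2 then show ?case unfolding fun_eq by (auto intro!: derivative_eq_intros z)
  next
    case 3 then show ?case unfolding fun_eq by (auto intro!: derivative_eq_intros z)
  next
    case 4 then show ?case unfolding fun_eq by (auto intro!: derivative_eq_intros z simp: algebra_simps)
  next
    case 5 then show ?case unfolding fun_eq by (intro has_vector_derivative_mult_right) simp
  qed
qed

lemma isCont_mode: "\<gamma> \<noteq> 0 \<Longrightarrow> isCont (mode \<gamma> A B c k) x"
  using mode_has_vector_derivative has_vector_derivative_continuous by blast

text \<open>Evaluating the conserved quantity
  \<open>F\<^sub>0(y) z\<^sub>1(x - y) + F\<^sub>1(y) z\<^sub>2(x - y) + F\<^sub>2(y) z\<^sub>3(x - y) + F\<^sub>3(y) z\<^sub>4(x - y)\<close>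
  at \<open>y = x\<close> and at \<open>y = c\<close> gives uniqueness.\<close>

lemma hinged_solution_eq_mode:
  assumes "\<gamma> \<noteq> 0" "convex S" "c \<in> S" "x \<in> S"
    and F: "\<And>k y. k < 4 \<Longrightarrow> y \<in> S \<Longrightarrow> (F k has_vector_derivative F (Suc k) y) (at y within S)"
    and ode: "\<And>y. y \<in> S \<Longrightarrow> F 4 y = - 4 * \<gamma>^4 * F 0 y"
    and hinge: "F 0 c = 0" "F 2 c = 0"
  shows "F 0 x = mode \<gamma> (F 1 c) (F 3 c) c 0 x"
proof -
  define \<Phi> where "\<Phi> y = F 0 y * z1 \<gamma> (x - y) + F 1 y * z2 \<gamma> (x - y) + F 2 y * z3 \<gamma> (x - y)
    + F 3 y * z4 \<gamma> (x - y)" for y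
  have "(\<Phi> has_vector_derivative 0) (at y within S)" if "y \<in> S" for y
  proof -
    have refl: "((\<lambda>y. x - y) has_vector_derivative - 1) (at y within S)"
      by (auto intro!: derivative_eq_intros)
    note z = z_comp_has_vector_derivative[OF \<open>\<gamma> \<noteq> 0\<close> refl, simplified]
    have Fs: "(F 0 has_vector_derivative F 1 y) (at y within S)"
      "(F 1 has_vector_derivative F 2 y) (at y within S)"
      "(F 2 has_vector_derivative F 3 y) (at y within S)"
      "(F 3 has_vector_derivative F 4 y) (at y within S)"
      using F[OF _ that, of 0] F[OF _ that, of 1] F[OF _ that, of 2] F[OF _ that, of 3]
      by (simp_all add: eval_nat_numeral)
    \<comment> \<open>The argument \<open>x - y\<close> reverses the sign of the derivatives of the
      fundamental system, so neighbouring terms cancel; the differential equation cancels the first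
      term against the last.\<close>
    have "(\<Phi> has_vector_derivative
        ((F 0 y * (4 * \<gamma>^4 * z4 \<gamma> (x - y)) + F 1 y * z1 \<gamma> (x - y))
        + (F 1 y * (- z1 \<gamma> (x - y)) + F 2 y * z2 \<gamma> (x - y))
        + (F 2 y * (- z2 \<gamma> (x - y)) + F 3 y * z3 \<gamma> (x - y))
        + (F 3 y * (- z3 \<gamma> (x - y)) + F 4 y * z4 \<gamma> (x - y)))) (at y within S)"
      unfolding \<Phi>_def[abs_def] by (intro has_vector_derivative_add has_vector_derivative_mult Fs z)
    then show ?thesis
      by (rule has_vector_derivative_eq_rhs) (simp add: ode[OF that])
  qed
  then obtain C where "\<And>y. y \<in> S \<Longrightarrow> \<Phi> y = C"
    using has_vector_derivative_zero_constant[OF \<open>convex S\<close>] by blast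
  then have "\<Phi> x = \<Phi> c"
    using assms by simp
  then show ?thesis
    by (simp add: \<Phi>_def hinge)
qed

section \<open>The matching system at the attachment point\<close>

lemma vector_4 [simp]:
  "(vector [a, b, c, d] :: 'a::zero^4) $ 1 = a"
  "(vector [a, b, c, d] :: 'a^4) $ 2 = b"
  "(vector [a, b, c, d] :: 'a^4) $ 3 = c"
  "(vector [a, b, c, d] :: 'a^4) $ 4 = d"
  by (simp_all add: vector_def)

text \<open>Each row of the matrix is a jump across \<open>l0\<close>, right mode minus left mode:
  of displacement, slope and bending in the first three rows, and of the third derivative in the
  last, where the term with \<open>\<beta>\<close> adds the shaker.\<close>

lemma shaker_matrix_mult_vec:
  "shaker_matrix l l0 \<gamma> \<beta> *v v = vector
     [mode \<gamma> (v $ 3) (v $ 4) l 0 l0 - mode \<gamma> (v $ 1) (v $ 2) 0 0 l0,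
      mode \<gamma> (v $ 3) (v $ 4) l 1 l0 - mode \<gamma> (v $ 1) (v $ 2) 0 1 l0,
      mode \<gamma> (v $ 3) (v $ 4) l 2 l0 - mode \<gamma> (v $ 1) (v $ 2) 0 2 l0,
      \<beta> * mode \<gamma> (v $ 1) (v $ 2) 0 0 l0 + mode \<gamma> (v $ 3) (v $ 4) l 3 l0 - mode \<gamma> (v $ 1) (v $ 2) 0 3 l0]"
  by (simp add: vec_eq_iff forall_4 matrix_vector_mult_def sum_4 shaker_matrix_def eval_nat_numeral
      algebra_simps)

lemma matrix_inv_mult_vec:
  fixes A :: "'a::semiring_1^'n^'n"
  assumes "invertible A"
  shows "A *v (matrix_inv A *v x) = x" and "matrix_inv A *v (A *v x) = x"
proof -
  have "A ** matrix_inv A = mat 1 \<and> matrix_inv A ** A = mat 1"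
    using assms unfolding invertible_def matrix_inv_def by (rule someI_ex)
  then show "A *v (matrix_inv A *v x) = x" "matrix_inv A *v (A *v x) = x"
    by (simp_all add: matrix_vector_mul_assoc)
qed

text \<open>The equation \<open>characteristic\<close> constrains only the fourth power of
  \<open>\<gamma>\<close>, which makes everything below independent of a choice of roots.\<close>

locale shaker_beam =
  fixes l l0 E I \<rho> m \<kappa> d :: real and s \<gamma> \<beta> :: complex
  assumes l0: "0 < l0" "l0 < l"
    and EI: "E * I \<noteq> 0"
    and \<gamma>: "\<gamma> \<noteq> 0"
    and nondegenerate: "of_real (E * I) + of_real (\<rho> * d) * s \<noteq> 0"
    and characteristic: "4 * \<gamma>^4 * (of_real (E * I) + of_real (\<rho> * d) * s) = of_real \<rho> * s^2"
    and \<beta>: "\<beta> = (s^2 * of_real m + of_real \<kappa>) / of_real (E * I)"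
begin

lemma l_pos: "0 < l"
  using l0 by simp

lemma ode_iff:
  "(of_real (E * I) + of_real (\<rho> * d) * s) * a + of_real \<rho> * s^2 * b = 0 \<longleftrightarrow> a = - 4 * \<gamma>^4 * b"
proof -
  have "(of_real (E * I) + of_real (\<rho> * d) * s) * a + of_real \<rho> * s^2 * b
      = (of_real (E * I) + of_real (\<rho> * d) * s) * (a + 4 * \<gamma>^4 * b)"
    unfolding characteristic[symmetric] by (simp only: ring_distribs ac_simps)
  then show ?thesis
    using nondegenerate by (simp add: eq_neg_iff_add_eq_0)
qed

text \<open>At \<open>l0\<close> the left mode is chosen. Under the matching conditions both modes
  agree there for \<open>k \<le> 2\<close>; for higher \<open>k\<close> the value at
  \<open>l0\<close> is a convention and is never evaluated.\<close>

definition response :: "complex^4 \<Rightarrow> nat \<Rightarrow> real \<Rightarrow> complex" where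
  "response v k x = (if x \<le> l0 then mode \<gamma> (v $ 1) (v $ 2) 0 k x else mode \<gamma> (v $ 3) (v $ 4) l k x)"

text \<open>Multiplied by \<open>E * I\<close>, the last row becomes the force balance, since
  \<open>\<beta>\<close> times \<open>E * I\<close> is the dynamic stiffness of the shaker. The
  homogeneous rows are the matching of orders 0, 1 and 2.\<close>

lemma system_iff:
  "shaker_matrix l l0 \<gamma> \<beta> *v v = vector [0, 0, 0, U / of_real (E * I)] \<longleftrightarrow>
     (\<forall>k<3. mode \<gamma> (v $ 1) (v $ 2) 0 k l0 = mode \<gamma> (v $ 3) (v $ 4) l k l0) \<and>
     (of_real m * s^2 + of_real \<kappa>) * mode \<gamma> (v $ 1) (v $ 2) 0 0 l0 =
       of_real (E * I) * mode \<gamma> (v $ 1) (v $ 2) 0 3 l0 - of_real (E * I) * mode \<gamma> (v $ 3) (v $ 4) l 3 l0 + U"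
proof -
  have k: "(\<forall>k<3. P k) \<longleftrightarrow> P 0 \<and> P 1 \<and> P (2::nat)" for P
    by (auto simp: eval_nat_numeral less_Suc_eq)
  have "complex_of_real (E * I) \<noteq> 0"
    using EI by (simp only: of_real_eq_0_iff not_False_eq_True)
  then have "\<beta> * a + c - b = U / of_real (E * I) \<longleftrightarrow>
      (of_real m * s^2 + of_real \<kappa>) * a = of_real (E * I) * b - of_real (E * I) * c + U" for a b c
    unfolding \<beta> by (simp add: field_simps del: of_real_mult)
  then show ?thesis
    unfolding shaker_matrix_mult_vec vec_eq_iff forall_4 k by (auto simp del: mode.simps)
qed

lemma has_vector_derivative_mode_cong:
  assumes "x \<in> S" "\<And>y. y \<in> S \<Longrightarrow> f y = mode \<gamma> A B c k y" "D = mode \<gamma> A B c (Suc k) x"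
  shows "(f has_vector_derivative D) (at x within S)"
  unfolding assms(3)
  by (rule has_vector_derivative_weaken[OF mode_has_vector_derivative[OF \<gamma>] assms(1) subset_UNIV])
    (simp add: assms(2))

lemma response_has_vector_derivative:
  assumes "x \<in> {0..l}" "x \<noteq> l0"
  shows "(response v k has_vector_derivative response v (Suc k) x) (at x within {0..l})"
proof (cases "x < l0")
  case True
  have "(response v k has_vector_derivative response v (Suc k) x) (at x within {0..<l0})"
    using True assms
    by (intro has_vector_derivative_mode_cong) (auto simp: response_def)
  then show ?thesis
    using True assms l0 by (simp add: at_within_openin[OF openin_Icc_pieces(3)])
next
  case False
  have "(response v k has_vector_derivative response v (Suc k) x) (at x within {l0<..l})"
    using False assms
    by (intro has_vector_derivative_mode_cong) (auto simp: response_def)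
  then show ?thesis
    using False assms l0 by (simp add: at_within_openin[OF openin_Icc_pieces(4)])
qed

text \<open>Matching at order \<open>k\<close> lets the response be read on \<open>{l0..l}\<close>
  as the right mode, so both one-sided derivatives exist; matching at order \<open>k + 1\<close>
  makes them equal. Since orders up to 2 match, \<open>k < 2\<close> is the range.\<close>

lemma response_has_vector_derivative_l0:
  assumes match: "\<And>k. k < 3 \<Longrightarrow> mode \<gamma> (v $ 1) (v $ 2) 0 k l0 = mode \<gamma> (v $ 3) (v $ 4) l k l0"
    and "k < 2"
  shows "(response v k has_vector_derivative response v (Suc k) l0) (at l0 within {0..l})"
proof -
  have "response v k x = mode \<gamma> (v $ 3) (v $ 4) l k x" if "x \<ge> l0" for x
    using match[of k] that \<open>k < 2\<close> by (cases "x = l0") (auto simp: response_def)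
  moreover have "response v (Suc k) l0 = mode \<gamma> (v $ 3) (v $ 4) l (Suc k) l0"
    using match[of "Suc k"] \<open>k < 2\<close> by (simp add: response_def del: mode.simps)
  ultimately have "(response v k has_vector_derivative response v (Suc k) l0) (at l0 within {l0..l})"
    using l0 by (intro has_vector_derivative_mode_cong) auto
  moreover have "(response v k has_vector_derivative response v (Suc k) l0) (at l0 within {0..l0})"
    using l0 by (intro has_vector_derivative_mode_cong) (auto simp: response_def)
  ultimately have "(response v k has_vector_derivative response v (Suc k) l0) (at l0 within {0..l0} \<union> {l0..l})"
    by (intro has_vector_derivative_within_Un)
  also have "{0..l0} \<union> {l0..l} = {0..l}"
    using l0 by auto
  finally show ?thesis .
qed

lemma tendsto_mode: "(mode \<gamma> A B c k \<longlongrightarrow> mode \<gamma> A B c k x) (at x within S)"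
  using isCont_mode[OF \<gamma>] by (metis isCont_def tendsto_within_subset subset_UNIV)

text \<open>Existence: the matching rows produce a profile of class C^2, the last row the force
  balance, and each mode satisfies the differential equation and its hinge by construction.\<close>

lemma transformed_problem_response:
  assumes "shaker_matrix l l0 \<gamma> \<beta> *v v = vector [0, 0, 0, U / of_real (E * I)]"
  shows "transformed_problem l l0 E I \<rho> m \<kappa> d s U (response v 0)"
proof -
  note sys = assms[unfolded system_iff]
  have der2: "(response v k has_vector_derivative response v (Suc k) x) (at x within {0..l})"
    if "k < 2" "x \<in> {0..l}" for k x
    using response_has_vector_derivative response_has_vector_derivative_l0 sys that by metis
  have der: "(response v k has_vector_derivative response v (Suc k) x) (at x within {0..l})"
    if "x \<in> {0..l} - {l0}" for k x
    using response_has_vector_derivative that by simp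
  have D2: "(deriv_x l ^^ 2) (response v 0) x = response v 2 x" if "x \<in> {0..l}" for x
    using deriv_x_funpow_eq[where F = "response v", OF l_pos openin_Icc_pieces(1) der2] that by blast
  have D: "(deriv_x l ^^ k) (response v 0) x = response v k x" if "x \<in> {0..l} - {l0}" for k x
    by (rule deriv_x_funpow_eq[where F = "response v", OF l_pos openin_Icc_pieces(2) der _ order_refl that]) auto
  have "continuous_on {0..l} (response v 2)"
    unfolding response_def[abs_def]
  proof (rule continuous_on_cases_le)
    show "mode \<gamma> (v $ 1) (v $ 2) 0 2 t = mode \<gamma> (v $ 3) (v $ 4) l 2 t" if "t = l0" for t
      using sys that by (simp del: mode.simps)
  qed (auto intro!: continuous_at_imp_continuous_on isCont_mode \<gamma> continuous_intros)
  then have "continuous_on {0..l} ((deriv_x l ^^ 2) (response v 0))"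
    using D2 by (subst continuous_on_cong[OF refl]) auto
  moreover have "differentiable_x l 2 {0..l} (response v 0)"
    by (rule differentiable_xI[where F = "response v", OF l_pos openin_Icc_pieces(1) der2]) auto
  moreover have "differentiable_x l 4 ({0..l} - {l0}) (response v 0)"
    by (rule differentiable_xI[where F = "response v", OF l_pos openin_Icc_pieces(2) der]) auto
  ultimately have "beam_profile l l0 (response v 0)"
    by (simp add: beam_profile_def)
  moreover have "hinged l (response v 0)"
    using l0 D2[of 0] D2[of l] by (simp add: hinged_def response_def eval_nat_numeral)
  moreover have "(of_real (E * I) + of_real (\<rho> * d) * s) * (deriv_x l ^^ 4) (response v 0) x
      + of_real \<rho> * s^2 * response v 0 x = 0" if "x \<in> {0..l} - {l0}" for x
    unfolding ode_iff D[OF that] by (simp add: response_def eval_nat_numeral)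
  moreover have "((deriv_x l ^^ 3) (response v 0) \<longlongrightarrow> mode \<gamma> (v $ 1) (v $ 2) 0 3 l0) (at_left l0)"
  proof (rule Lim_transform_eventually[OF tendsto_mode])
    show "\<forall>\<^sub>F x in at_left l0. mode \<gamma> (v $ 1) (v $ 2) 0 3 x = (deriv_x l ^^ 3) (response v 0) x"
      using eventually_at_left_real[OF l0(1)]
      by eventually_elim (use l0 in \<open>simp add: D response_def del: mode.simps\<close>)
  qed
  moreover have "((deriv_x l ^^ 3) (response v 0) \<longlongrightarrow> mode \<gamma> (v $ 3) (v $ 4) l 3 l0) (at_right l0)"
  proof (rule Lim_transform_eventually[OF tendsto_mode])
    show "\<forall>\<^sub>F x in at_right l0. mode \<gamma> (v $ 3) (v $ 4) l 3 x = (deriv_x l ^^ 3) (response v 0) x"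
      using eventually_at_right_real[OF l0(2)]
      by eventually_elim (use l0 in \<open>simp add: D response_def del: mode.simps\<close>)
  qed
  moreover have "response v 0 l0 = mode \<gamma> (v $ 1) (v $ 2) 0 0 l0"
    by (simp add: response_def)
  ultimately show ?thesis
    unfolding transformed_problem_def using sys by metis
qed

text \<open>Uniqueness: the hinges force a mode on each side. Comparing its limits at
  \<open>l0\<close> with the continuity of orders 0 to 2, and with the one-sided limits of the third
  derivative, gives the linear system.\<close>

lemma transformed_problem_solution:
  assumes "transformed_problem l l0 E I \<rho> m \<kappa> d s U W"
  obtains v where "shaker_matrix l l0 \<gamma> \<beta> *v v = vector [0, 0, 0, U / of_real (E * I)]"
    and "\<And>x. x \<in> {0..l0} \<Longrightarrow> (deriv_x l ^^ 2) W x = mode \<gamma> (v $ 1) (v $ 2) 0 2 x"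
proof -
  define F where "F k = (deriv_x l ^^ k) W" for k
  have profile: "differentiable_x l 2 {0..l} W" "continuous_on {0..l} (F 2)"
      "differentiable_x l 4 ({0..l} - {l0}) W"
    and hinges: "F 0 0 = 0" "F 0 l = 0" "F 2 0 = 0" "F 2 l = 0"
    using assms by (auto simp: transformed_problem_def beam_profile_def hinged_def F_def)
  have ode: "F 4 x = - 4 * \<gamma>^4 * F 0 x" if "x \<in> {0..l} - {l0}" for x
    using assms that unfolding transformed_problem_def ode_iff F_def by simp
  from assms obtain a b where ab: "(F 3 \<longlongrightarrow> a) (at_left l0)" "(F 3 \<longlongrightarrow> b) (at_right l0)"
    "(of_real m * s^2 + of_real \<kappa>) * F 0 l0 = of_real (E * I) * a - of_real (E * I) * b + U"
    unfolding transformed_problem_def F_def by auto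
  \<comment> \<open>Orders 0 and 2 vanish at a hinge, so the first and third derivatives there are
    the remaining Cauchy data and hence the coefficients of the mode.\<close>
  define A B C D where "A = F 1 0" and "B = F 3 0" and "C = F 1 l" and "D = F 3 l"
  have der: "(F k has_vector_derivative F (Suc k) x) (at x within {0..l})"
    if "k < 4" "x \<in> {0..l} - {l0}" for k x
    unfolding F_def by (rule differentiable_x_has_vector_derivative[OF profile(3) that])
  have left0: "F 0 x = mode \<gamma> A B 0 0 x" if "x \<in> {0..<l0}" for x
    unfolding A_def B_def
  proof (rule hinged_solution_eq_mode[where S = "{0..<l0}"])
    show "(F k has_vector_derivative F (Suc k) y) (at y within {0..<l0})" if "k < 4" "y \<in> {0..<l0}" for k y
      using der[of k y] that l0 by (simp add: at_within_openin[OF openin_Icc_pieces(3)])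
  qed (use that l0 \<gamma> ode hinges in auto)
  have right0: "F 0 x = mode \<gamma> C D l 0 x" if "x \<in> {l0<..l}" for x
    unfolding C_def D_def
  proof (rule hinged_solution_eq_mode[where S = "{l0<..l}"])
    show "(F k has_vector_derivative F (Suc k) y) (at y within {l0<..l})" if "k < 4" "y \<in> {l0<..l}" for k y
      using der[of k y] that l0 by (simp add: at_within_openin[OF openin_Icc_pieces(4)])
  qed (use that l0 \<gamma> ode hinges in auto)
  have left: "F k x = mode \<gamma> A B 0 k x" if "x \<in> {0..<l0}" for k x
    unfolding F_def
    by (rule deriv_x_funpow_eq[where F = "mode \<gamma> A B 0", OF l_pos openin_Icc_pieces(3)[OF l0(2)]
        mode_has_vector_derivative[OF \<gamma>] _ order_refl that])
      (use left0 in \<open>simp add: F_def del: mode.simps\<close>)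
  have right: "F k x = mode \<gamma> C D l k x" if "x \<in> {l0<..l}" for k x
    unfolding F_def
    by (rule deriv_x_funpow_eq[where F = "mode \<gamma> C D l", OF l_pos openin_Icc_pieces(4)[OF l0(1)]
        mode_has_vector_derivative[OF \<gamma>] _ order_refl that])
      (use right0 in \<open>simp add: F_def del: mode.simps\<close>)
  have lim_left: "(F k \<longlongrightarrow> mode \<gamma> A B 0 k l0) (at_left l0)" for k
  proof (rule Lim_transform_eventually[OF tendsto_mode])
    show "\<forall>\<^sub>F x in at_left l0. mode \<gamma> A B 0 k x = F k x"
      using eventually_at_left_real[OF l0(1)] by eventually_elim (simp add: left)
  qed
  have lim_right: "(F k \<longlongrightarrow> mode \<gamma> C D l k l0) (at_right l0)" for k
  proof (rule Lim_transform_eventually[OF tendsto_mode])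
    show "\<forall>\<^sub>F x in at_right l0. mode \<gamma> C D l k x = F k x"
      using eventually_at_right_real[OF l0(2)] by eventually_elim (simp add: right)
  qed
  \<comment> \<open>Orders 0 and 1 are continuous because they are differentiable on the whole beam;
    order 2 is continuous by a separate clause of \<open>beam_profile\<close>.\<close>
  have "continuous_on {0..l} (F k)" if "k < 3" for k
  proof (cases "k = 2")
    case False
    then have "k < 2"
      using that by simp
    then show ?thesis
      using differentiable_x_has_vector_derivative[OF profile(1)]
      by (metis F_def continuous_on_eq_continuous_within has_vector_derivative_continuous)
  qed (use profile in simp)
  then have "isCont (F k) l0" if "k < 3" for k
    using that l0 continuous_on_interior[of "{0..l}" "F k" l0] by auto
  then have lim: "(F k \<longlongrightarrow> F k l0) (at_left l0)" "(F k \<longlongrightarrow> F k l0) (at_right l0)" if "k < 3" for k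
    using that by (auto simp: isCont_def intro: tendsto_within_subset)
  have at_l0: "F k l0 = mode \<gamma> A B 0 k l0" "F k l0 = mode \<gamma> C D l k l0" if "k < 3" for k
    using tendsto_unique[OF _ lim(1)[OF that] lim_left] tendsto_unique[OF _ lim(2)[OF that] lim_right]
    by (auto simp del: mode.simps)
  have "a = mode \<gamma> A B 0 3 l0" "b = mode \<gamma> C D l 3 l0"
    using tendsto_unique[OF _ ab(1) lim_left] tendsto_unique[OF _ ab(2) lim_right]
    by (auto simp del: mode.simps)
  with ab(3) at_l0 have "shaker_matrix l l0 \<gamma> \<beta> *v vector [A, B, C, D] = vector [0, 0, 0, U / of_real (E * I)]"
    unfolding system_iff by (auto simp del: mode.simps)
  \<comment> \<open>At \<open>x = l0\<close> the left mode is reached only through continuity. This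
    case matters because the sensor may sit at the attachment point.\<close>
  moreover have "(deriv_x l ^^ 2) W x = mode \<gamma> ((vector [A, B, C, D] :: complex^4) $ 1)
      ((vector [A, B, C, D] :: complex^4) $ 2) 0 2 x"
    if "x \<in> {0..l0}" for x
    using left[of x 2] at_l0(1)[of 2] that by (cases "x = l0") (auto simp: F_def simp del: mode.simps)
  ultimately show thesis
    by (rule that)
qed

lemma transformed_problem_output:
  assumes "invertible (shaker_matrix l l0 \<gamma> \<beta>)" "transformed_problem l l0 E I \<rho> m \<kappa> d s U W"
    and "l1 \<in> {0..l0}"
  defines "N \<equiv> matrix_inv (shaker_matrix l l0 \<gamma> \<beta>)"
  shows "(deriv_x l ^^ 2) W l1 =
    1 / of_real (E * I) * (- 4 * \<gamma>^4 * z4 \<gamma> l1 * N $ 1 $ 4 + z2 \<gamma> l1 * N $ 2 $ 4) * U"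
proof -
  obtain v where v: "shaker_matrix l l0 \<gamma> \<beta> *v v = vector [0, 0, 0, U / of_real (E * I)]"
    "(deriv_x l ^^ 2) W l1 = mode \<gamma> (v $ 1) (v $ 2) 0 2 l1"
    using transformed_problem_solution[OF assms(2)] assms(3) by blast
  have "v = N *v vector [0, 0, 0, U / of_real (E * I)]"
    unfolding v(1)[symmetric] N_def using matrix_inv_mult_vec(2)[OF assms(1)] by simp
  \<comment> \<open>Only the last entry of the right-hand side is nonzero, so only the fourth column
    of \<open>N\<close> contributes.\<close>
  then have "v $ i = N $ i $ 4 * (U / of_real (E * I))" for i
    by (simp add: matrix_vector_mult_def sum_4)
  then show ?thesis
    unfolding v(2) by (simp add: eval_nat_numeral algebra_simps)
qed

lemma transformed_problem_solvable:
  assumes "invertible (shaker_matrix l l0 \<gamma> \<beta>)"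
  shows "\<exists>W. transformed_problem l l0 E I \<rho> m \<kappa> d s U W"
  using transformed_problem_response matrix_inv_mult_vec(1)[OF assms] by blast

end

section \<open>Transforming trajectories\<close>

text \<open>With the position before the time, \<open>profile_deriv l k f x\<close> is a function of
  time to which \<open>laplace\<close> applies.\<close>

definition profile_deriv :: "real \<Rightarrow> nat \<Rightarrow> (real \<Rightarrow> real \<Rightarrow> real) \<Rightarrow> real \<Rightarrow> real \<Rightarrow> real" where
  "profile_deriv l k f x t = (deriv_x l ^^ k) (\<lambda>x. f x t) x"

lemma profile_deriv_0 [simp]: "profile_deriv l 0 f x = f x"
  by (simp add: profile_deriv_def fun_eq_iff)

text \<open>Differentiation under the integral sign is iterated: each step yields the integrability
  of the next derivative, so it is assumed only for \<open>f\<close> itself. Convexity of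
  \<open>S\<close> serves the mean value inequality, and openness the return from \<open>S\<close>
  to the beam.\<close>

lemma laplace_profile_deriv:
  assumes "0 < l" and S: "openin (top_of_set {0..l}) S" "convex S"
    and \<sigma>: "\<sigma> < Re s"
    and diff: "\<And>t. t \<ge> 0 \<Longrightarrow> differentiable_x l n S (\<lambda>x. f x t)"
    and bound: "\<And>k x t. k \<le> n \<Longrightarrow> x \<in> S \<Longrightarrow> t \<ge> 0 \<Longrightarrow> \<bar>profile_deriv l k f x t\<bar> \<le> C * exp (\<sigma> * t)"
    and int: "\<And>x. x \<in> S \<Longrightarrow> laplace_integrand s (f x) integrable_on {0..}"
  shows "k \<le> n \<Longrightarrow> x \<in> S \<Longrightarrow> laplace_integrand s (profile_deriv l k f x) integrable_on {0..}"
    and "k < n \<Longrightarrow> x \<in> S \<Longrightarrow> ((\<lambda>x. laplace s (profile_deriv l k f x)) has_vector_derivative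
      laplace s (profile_deriv l (Suc k) f x)) (at x within {0..l})"
proof -
  have step: "laplace_integrand s (profile_deriv l (Suc k) f x) integrable_on {0..} \<and>
      ((\<lambda>x. laplace s (profile_deriv l k f x)) has_vector_derivative
        laplace s (profile_deriv l (Suc k) f x)) (at x within S)"
    if "k < n" "x \<in> S" and int_k: "\<And>y. y \<in> S \<Longrightarrow> laplace_integrand s (profile_deriv l k f y) integrable_on {0..}"
    for k x
  proof -
    have "S \<subseteq> {0..l}"
      using S(1) openin_imp_subset by blast
    then have "x islimpt {0..l}"
      using \<open>0 < l\<close> \<open>x \<in> S\<close> by (auto simp: islimpt_Icc)
    \<comment> \<open>The filters within \<open>S\<close> and within the beam coincide, so
      nontriviality of the one carries over to the other.\<close>
    then have limpt: "x islimpt S"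
      using at_within_openin[OF S(1) \<open>x \<in> S\<close>] by (metis trivial_limit_within)
    have der: "((\<lambda>y. laplace_integrand s (profile_deriv l k f y) t) has_vector_derivative
        laplace_integrand s (profile_deriv l (Suc k) f y) t) (at y within S)"
      if "y \<in> S" "t \<in> {0..}" for y t
    proof -
      have "((\<lambda>y. profile_deriv l k f y t) has_vector_derivative profile_deriv l (Suc k) f y t) (at y within S)"
        using differentiable_x_has_vector_derivative[OF diff \<open>k < n\<close> \<open>y \<in> S\<close>, of t] that
        by (simp add: profile_deriv_def at_within_openin[OF S(1)])
      then show ?thesis
        unfolding laplace_integrand_def
        by (intro has_vector_derivative_mult_left bounded_linear.has_vector_derivative[OF bounded_linear_of_real])
    qed
    have le: "norm (laplace_integrand s (profile_deriv l (Suc k) f y) t) \<le> C * exp (- (Re s - \<sigma>) * t)"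
      if "y \<in> S" "t \<in> {0..}" for y t
      using bound[of "Suc k" y t] that \<open>k < n\<close> by (intro norm_laplace_integrand_le) simp
    show ?thesis
      using has_vector_derivative_integral_dominated[OF \<open>convex S\<close> \<open>x \<in> S\<close> limpt int_k integrable_exp_bound[OF \<sigma>] der le]
      unfolding laplace_def by blast
  qed
  have int_k: "laplace_integrand s (profile_deriv l k f x) integrable_on {0..}" if "k \<le> n" "x \<in> S" for k x
    using that by (induction k arbitrary: x) (use int step in auto)
  then show "k \<le> n \<Longrightarrow> x \<in> S \<Longrightarrow> laplace_integrand s (profile_deriv l k f x) integrable_on {0..}" .
  show "((\<lambda>x. laplace s (profile_deriv l k f x)) has_vector_derivative
      laplace s (profile_deriv l (Suc k) f x)) (at x within {0..l})" if "k < n" "x \<in> S"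
    using step[OF that] int_k that by (simp add: at_within_openin[OF S(1)])
qed

section \<open>From a trajectory to the transformed problem\<close>

locale transformable_trajectory =
  fixes l l0 E I \<rho> m \<kappa> d :: real and s :: complex and u0 :: "real \<Rightarrow> real" and w :: "real \<Rightarrow> real \<Rightarrow> real"
    and C \<sigma> :: real
  assumes l0: "0 < l0" "l0 < l" and \<rho>: "\<rho> \<noteq> 0"
    and trajectory: "beam_trajectory l l0 E I \<rho> m \<kappa> d u0 w"
    and \<sigma>: "\<sigma> < Re s"
    and bound_t: "\<And>x t j. x \<in> {0..l} \<Longrightarrow> t \<ge> 0 \<Longrightarrow> j \<le> 2 \<Longrightarrow> \<bar>(deriv_t ^^ j) (w x) t\<bar> \<le> C * exp (\<sigma> * t)"
    and bound_x: "\<And>x t k. x \<in> {0..l} - {l0} \<Longrightarrow> t \<ge> 0 \<Longrightarrow> k \<le> 4 \<Longrightarrow> \<bar>profile_deriv l k w x t\<bar> \<le> C * exp (\<sigma> * t)"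
    and bound_xt: "\<And>x t k. x \<in> {0..l} - {l0} \<Longrightarrow> t \<ge> 0 \<Longrightarrow> k \<le> 4 \<Longrightarrow>
      \<bar>profile_deriv l k (\<lambda>x. deriv_t (w x)) x t\<bar> \<le> C * exp (\<sigma> * t)"
begin

lemma l_pos: "0 < l"
  using l0 by simp

lemma profile: "t \<ge> 0 \<Longrightarrow> beam_profile l l0 (\<lambda>x. w x t)"
  and velocity_profile: "t \<ge> 0 \<Longrightarrow> differentiable_x l 4 ({0..l} - {l0}) (\<lambda>x. deriv_t (w x) t)"
  and differentiable_t: "x \<in> {0..l} \<Longrightarrow> t \<ge> 0 \<Longrightarrow> w x differentiable (at t within {0..})"
    "x \<in> {0..l} \<Longrightarrow> t \<ge> 0 \<Longrightarrow> deriv_t (w x) differentiable (at t within {0..})"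
  and pde: "x \<in> {0..l} - {l0} \<Longrightarrow> t \<ge> 0 \<Longrightarrow> deriv_t (deriv_t (w x)) t + E * I / \<rho> * profile_deriv l 4 w x t
      + d * profile_deriv l 4 (\<lambda>x. deriv_t (w x)) x t = 0"
  and hinged_ends: "t \<ge> 0 \<Longrightarrow> hinged l (\<lambda>x. w x t)"
  and initial: "x \<in> {0..l} \<Longrightarrow> w x 0 = 0" "x \<in> {0..l} \<Longrightarrow> deriv_t (w x) 0 = 0"
  using trajectory unfolding beam_trajectory_def profile_deriv_def by (simp_all add: eval_nat_numeral)

text \<open>The derivatives up to order 2 are continuous on the whole beam, so the bound known away
  from \<open>l0\<close> passes to the limit at \<open>l0\<close>.\<close>

lemma bound_x_l0:
  assumes "x \<in> {0..l}" "t \<ge> 0" "k \<le> 2"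
  shows "\<bar>profile_deriv l k w x t\<bar> \<le> C * exp (\<sigma> * t)"
proof (cases "x = l0")
  case True
  have "continuous (at l0 within {0..l}) (\<lambda>x. profile_deriv l k w x t)"
  proof (cases "k = 2")
    case True
    then show ?thesis
      using profile[OF \<open>t \<ge> 0\<close>] l0 by (simp add: beam_profile_def continuous_on_eq_continuous_within profile_deriv_def)
  next
    case False
    then show ?thesis
      using differentiable_x_has_vector_derivative[of l 2 "{0..l}" "\<lambda>x. w x t" k l0] profile[OF \<open>t \<ge> 0\<close>] assms l0
      by (auto simp: beam_profile_def profile_deriv_def intro: has_vector_derivative_continuous)
  qed
  then have "((\<lambda>x. \<bar>profile_deriv l k w x t\<bar>) \<longlongrightarrow> \<bar>profile_deriv l k w l0 t\<bar>) (at l0 within {0..l})"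
    by (intro tendsto_rabs) (simp add: continuous_within)
  moreover have "\<forall>\<^sub>F x in at l0 within {0..l}. \<bar>profile_deriv l k w x t\<bar> \<le> C * exp (\<sigma> * t)"
    unfolding eventually_at_filter using assms bound_x by (intro always_eventually) auto
  moreover have "at l0 within {0..l} \<noteq> bot"
    using l0 by (simp add: trivial_limit_within islimpt_Icc)
  ultimately show ?thesis
    unfolding True using tendsto_upperbound by blast
qed (use assms bound_x in auto)

lemma laplace_t:
  assumes "x \<in> {0..l}"
  shows "has_laplace (w x) s (laplace s (w x))"
    and "has_laplace (deriv_t (w x)) s (s * laplace s (w x))"
    and "has_laplace (deriv_t (deriv_t (w x))) s (s^2 * laplace s (w x))"
proof -
  have bounds: "\<bar>w x t\<bar> \<le> C * exp (\<sigma> * t)" "\<bar>deriv_t (w x) t\<bar> \<le> C * exp (\<sigma> * t)"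
    "\<bar>deriv_t (deriv_t (w x)) t\<bar> \<le> C * exp (\<sigma> * t)" if "t \<ge> 0" for t
    using bound_t[OF assms that, of 0] bound_t[OF assms that, of 1] bound_t[OF assms that, of 2]
    by (simp_all add: eval_nat_numeral)
  have "continuous_on {0..} (w x)"
    using differentiable_t(1)[OF assms]
    by (auto simp: continuous_on_eq_continuous_within intro: differentiable_imp_continuous_within)
  then show "has_laplace (w x) s (laplace s (w x))"
    using laplace_integrand_continuous_integrable[OF \<sigma>] bounds(1) by (intro has_laplace_laplace) blast
  note L1 = laplace_deriv_t[OF \<sigma> differentiable_t(1)[OF assms] bounds(1,2) initial(1)[OF assms]]
  note L2 = laplace_deriv_t[OF \<sigma> differentiable_t(2)[OF assms] bounds(2,3) initial(2)[OF assms]]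
  show "has_laplace (deriv_t (w x)) s (s * laplace s (w x))"
    using has_laplace_laplace[OF L1(1)] by (simp only: L1(2))
  have "s^2 * laplace s (w x) = laplace s (deriv_t (deriv_t (w x)))"
    using L1(2) L2(2) by (simp add: power2_eq_square)
  then show "has_laplace (deriv_t (deriv_t (w x))) s (s^2 * laplace s (w x))"
    using has_laplace_laplace[OF L2(1)] by simp
qed

lemma integrable_t:
  assumes "x \<in> {0..l}"
  shows "laplace_integrand s (w x) integrable_on {0..}" "laplace_integrand s (deriv_t (w x)) integrable_on {0..}"
  using laplace_t(1,2)[OF assms] unfolding has_laplace_iff by blast+

text \<open>The punctured beam is not convex, while differentiation under the integral sign works on
  a convex set; each point is therefore placed in one of the two half-open pieces.\<close>

lemma punctured_cases:
  assumes "x \<in> {0..l} - {l0}"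
  obtains S where "openin (top_of_set {0..l}) S" "convex S" "x \<in> S" "S \<subseteq> {0..l} - {l0}"
proof (cases "x < l0")
  case True
  then show thesis
    using assms l0 by (intro that[of "{0..<l0}"] openin_Icc_pieces) auto
next
  case False
  then show thesis
    using assms l0 by (intro that[of "{l0<..l}"] openin_Icc_pieces) auto
qed

lemma laplace_w:
  assumes "x \<in> {0..l} - {l0}"
  shows "k \<le> 4 \<Longrightarrow> laplace_integrand s (profile_deriv l k w x) integrable_on {0..}"
    and "k < 4 \<Longrightarrow> ((\<lambda>x. laplace s (profile_deriv l k w x)) has_vector_derivative
      laplace s (profile_deriv l (Suc k) w x)) (at x within {0..l})"
proof -
  obtain S where S: "openin (top_of_set {0..l}) S" "convex S" "x \<in> S" "S \<subseteq> {0..l} - {l0}"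
    using punctured_cases[OF assms] .
  have diff: "differentiable_x l 4 S (\<lambda>x. w x t)" if "t \<ge> 0" for t
    using profile[OF that] S(4) differentiable_x_subset unfolding beam_profile_def by blast
  note chain = laplace_profile_deriv[where n = 4 and f = w and C = C, OF l_pos S(1,2) \<sigma> diff]
  show "laplace_integrand s (profile_deriv l k w x) integrable_on {0..}" if "k \<le> 4"
    using S(3,4) by (intro chain(1) that) (auto intro!: bound_x integrable_t)
  show "((\<lambda>x. laplace s (profile_deriv l k w x)) has_vector_derivative
      laplace s (profile_deriv l (Suc k) w x)) (at x within {0..l})" if "k < 4"
    using S(3,4) by (intro chain(2) that) (auto intro!: bound_x integrable_t)
qed

lemma laplace_velocity:
  assumes "x \<in> {0..l} - {l0}"
  shows "k \<le> 4 \<Longrightarrow> laplace_integrand s (profile_deriv l k (\<lambda>x. deriv_t (w x)) x) integrable_on {0..}"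
    and "k < 4 \<Longrightarrow> ((\<lambda>x. laplace s (profile_deriv l k (\<lambda>x. deriv_t (w x)) x)) has_vector_derivative
      laplace s (profile_deriv l (Suc k) (\<lambda>x. deriv_t (w x)) x)) (at x within {0..l})"
proof -
  obtain S where S: "openin (top_of_set {0..l}) S" "convex S" "x \<in> S" "S \<subseteq> {0..l} - {l0}"
    using punctured_cases[OF assms] .
  have diff: "differentiable_x l 4 S (\<lambda>x. deriv_t (w x) t)" if "t \<ge> 0" for t
    using velocity_profile[OF that] S(4) differentiable_x_subset by blast
  note chain = laplace_profile_deriv[where n = 4 and f = "\<lambda>x. deriv_t (w x)" and C = C,
      OF l_pos S(1,2) \<sigma> diff]
  show "laplace_integrand s (profile_deriv l k (\<lambda>x. deriv_t (w x)) x) integrable_on {0..}" if "k \<le> 4"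
    using S(3,4) by (intro chain(1) that) (auto intro!: bound_xt integrable_t)
  show "((\<lambda>x. laplace s (profile_deriv l k (\<lambda>x. deriv_t (w x)) x)) has_vector_derivative
      laplace s (profile_deriv l (Suc k) (\<lambda>x. deriv_t (w x)) x)) (at x within {0..l})" if "k < 4"
    using S(3,4) by (intro chain(2) that) (auto intro!: bound_xt integrable_t)
qed

lemma laplace_w_C2:
  assumes "x \<in> {0..l}"
  shows "k \<le> 2 \<Longrightarrow> laplace_integrand s (profile_deriv l k w x) integrable_on {0..}"
    and "k < 2 \<Longrightarrow> ((\<lambda>x. laplace s (profile_deriv l k w x)) has_vector_derivative
      laplace s (profile_deriv l (Suc k) w x)) (at x within {0..l})"
proof -
  have diff: "differentiable_x l 2 {0..l} (\<lambda>x. w x t)" if "t \<ge> 0" for t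
    using profile[OF that] unfolding beam_profile_def by blast
  note chain = laplace_profile_deriv[where n = 2 and f = w and C = C,
      OF l_pos openin_Icc_pieces(1) convex_real_interval(5) \<sigma> diff]
  show "laplace_integrand s (profile_deriv l k w x) integrable_on {0..}" if "k \<le> 2"
    by (intro chain(1) that assms) (auto intro!: bound_x_l0 integrable_t)
  show "((\<lambda>x. laplace s (profile_deriv l k w x)) has_vector_derivative
      laplace s (profile_deriv l (Suc k) w x)) (at x within {0..l})" if "k < 2"
    by (intro chain(2) that assms) (auto intro!: bound_x_l0 integrable_t)
qed

lemma deriv_x_laplace:
  shows "x \<in> {0..l} - {l0} \<Longrightarrow> k \<le> 4 \<Longrightarrow>
      (deriv_x l ^^ k) (\<lambda>x. laplace s (w x)) x = laplace s (profile_deriv l k w x)"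
    and "x \<in> {0..l} \<Longrightarrow> k \<le> 2 \<Longrightarrow>
      (deriv_x l ^^ k) (\<lambda>x. laplace s (w x)) x = laplace s (profile_deriv l k w x)"
  using deriv_x_funpow_eq[where F = "\<lambda>k x. laplace s (profile_deriv l k w x)" and n = 4,
      OF l_pos openin_Icc_pieces(2) laplace_w(2), of l0 "\<lambda>x. laplace s (w x)" k x]
    deriv_x_funpow_eq[where F = "\<lambda>k x. laplace s (profile_deriv l k w x)" and n = 2,
      OF l_pos openin_Icc_pieces(1) laplace_w_C2(2), of "\<lambda>x. laplace s (w x)" k x]
  by auto

text \<open>Time and space derivatives are not interchanged pointwise. The transform of the velocity
  is \<open>s * laplace s (w x)\<close> at every point of the beam, and computing the fourth
  derivative in \<open>x\<close> of this one function in two ways gives the claim.\<close>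

lemma laplace_velocity_eq:
  assumes "x \<in> {0..l} - {l0}"
  shows "laplace s (profile_deriv l 4 (\<lambda>x. deriv_t (w x)) x) = s * laplace s (profile_deriv l 4 w x)"
proof -
  have init: "laplace s (deriv_t (w x)) = s * laplace s (w x)" if "x \<in> {0..l}" for x
    using has_laplace_unique[OF laplace_t(2)[OF that]] has_laplace_laplace[OF integrable_t(2)[OF that]] by simp
  have "(deriv_x l ^^ 4) (\<lambda>x. laplace s (deriv_t (w x))) x = laplace s (profile_deriv l 4 (\<lambda>x. deriv_t (w x)) x)"
    by (rule deriv_x_funpow_eq[where F = "\<lambda>k x. laplace s (profile_deriv l k (\<lambda>x. deriv_t (w x)) x)" and n = 4,
          OF l_pos openin_Icc_pieces(2) laplace_velocity(2)]) (use assms in auto)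
  moreover have "(deriv_x l ^^ 4) (\<lambda>x. laplace s (deriv_t (w x))) x = s * laplace s (profile_deriv l 4 w x)"
    by (rule deriv_x_funpow_eq[where F = "\<lambda>k x. s * laplace s (profile_deriv l k w x)" and n = 4,
          OF l_pos openin_Icc_pieces(2) has_vector_derivative_mult_right[OF laplace_w(2)]]) (use assms init in auto)
  ultimately show ?thesis
    by simp
qed

lemma laplace_pde:
  assumes "x \<in> {0..l} - {l0}"
  shows "(of_real (E * I) + of_real (\<rho> * d) * s) * laplace s (profile_deriv l 4 w x)
    + of_real \<rho> * s^2 * laplace s (w x) = 0"
proof -
  have "has_laplace (\<lambda>t. deriv_t (deriv_t (w x)) t + E * I / \<rho> * profile_deriv l 4 w x t
      + d * profile_deriv l 4 (\<lambda>x. deriv_t (w x)) x t) s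
      (s^2 * laplace s (w x) + of_real (E * I / \<rho>) * laplace s (profile_deriv l 4 w x)
      + of_real d * laplace s (profile_deriv l 4 (\<lambda>x. deriv_t (w x)) x))"
    using assms by (intro has_laplace_add has_laplace_cmult laplace_t has_laplace_laplace laplace_w(1)
        laplace_velocity(1)) auto
  \<comment> \<open>By the equation of motion the transformed combination is zero for
    \<open>t \<ge> 0\<close>, so uniqueness of the transform will make the right-hand side
    zero.\<close>
  then have "has_laplace (\<lambda>t. 0) s (s^2 * laplace s (w x) + of_real (E * I / \<rho>) * laplace s (profile_deriv l 4 w x)
      + of_real d * (s * laplace s (profile_deriv l 4 w x)))"
    unfolding laplace_velocity_eq[OF assms] by (rule has_laplace_eq) (use pde[OF assms] in simp)
  then have "s^2 * laplace s (w x) + of_real (E * I / \<rho>) * laplace s (profile_deriv l 4 w x)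
      + of_real d * (s * laplace s (profile_deriv l 4 w x)) = 0"
    using has_laplace_unique has_laplace_0 by blast
  then have "of_real \<rho> * (s^2 * laplace s (w x) + of_real (E * I / \<rho>) * laplace s (profile_deriv l 4 w x)
      + of_real d * (s * laplace s (profile_deriv l 4 w x))) = 0"
    by (simp only: mult_zero_right)
  moreover have "of_real \<rho> * complex_of_real (E * I / \<rho>) = of_real (E * I)"
    using \<rho> unfolding of_real_mult[symmetric] by simp
  ultimately show ?thesis
    by (simp only: of_real_mult[of \<rho> d] ring_distribs mult.assoc[symmetric]) (simp only: ac_simps)
qed

text \<open>The bending is continuous in \<open>x\<close> at each time, and one exponential bound
  dominates it uniformly along the beam, so continuity survives integration in time.\<close>

lemma continuous_laplace_bending: "continuous_on {0..l} (\<lambda>x. laplace s (profile_deriv l 2 w x))"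
  unfolding continuous_on_def
proof
  fix x assume x: "x \<in> {0..l}"
  have "continuous_on {0..l} (\<lambda>x. profile_deriv l 2 w x t)" if "t \<ge> 0" for t
    using profile[OF that] by (simp add: beam_profile_def profile_deriv_def)
  then have conv: "((\<lambda>x. laplace_integrand s (profile_deriv l 2 w x) t) \<longlongrightarrow>
      laplace_integrand s (profile_deriv l 2 w x) t) (at x within {0..l})" if "t \<in> {0..}" for t
    using x that unfolding laplace_integrand_def continuous_on_def by (intro tendsto_intros) auto
  show "((\<lambda>x. laplace s (profile_deriv l 2 w x)) \<longlongrightarrow> laplace s (profile_deriv l 2 w x)) (at x within {0..l})"
    unfolding laplace_def
  proof (rule tendsto_integral_dominated(2)[OF _ _ integrable_exp_bound[OF \<sigma>] _ conv])
    show "norm (laplace_integrand s (profile_deriv l 2 w y) t) \<le> C * exp (- (Re s - \<sigma>) * t)"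
      if "y \<in> {0..l} - {x}" "t \<in> {0..}" for y t
      using that by (intro norm_laplace_integrand_le bound_x_l0) auto
  qed (use x l0 in \<open>auto simp: islimpt_Icc intro!: laplace_w_C2\<close>)
qed

text \<open>The one-sided trace \<open>a\<close> is known only as a pointwise limit at each time;
  dominated convergence makes it transformable and moves the limit through the integral.\<close>

lemma laplace_one_sided_limit:
  assumes "S \<subseteq> {0..l}" "l0 islimpt S"
    and lim: "\<And>t. t \<ge> 0 \<Longrightarrow> ((\<lambda>x. profile_deriv l 3 w x t) \<longlongrightarrow> a t) (at l0 within S)"
  shows "has_laplace a s (laplace s a)"
    and "((\<lambda>x. laplace s (profile_deriv l 3 w x)) \<longlongrightarrow> laplace s a) (at l0 within S)"
proof -
  have int: "laplace_integrand s (profile_deriv l 3 w y) integrable_on {0..}" if "y \<in> S - {l0}" for y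
    using that assms(1) by (intro laplace_w) auto
  have le: "norm (laplace_integrand s (profile_deriv l 3 w y) t) \<le> C * exp (- (Re s - \<sigma>) * t)"
    if "y \<in> S - {l0}" "t \<in> {0..}" for y t
    using that assms(1) by (intro norm_laplace_integrand_le bound_x) auto
  have conv: "((\<lambda>x. laplace_integrand s (profile_deriv l 3 w x) t) \<longlongrightarrow> laplace_integrand s a t) (at l0 within S)"
    if "t \<in> {0..}" for t
    unfolding laplace_integrand_def using lim that by (intro tendsto_intros) auto
  note dominated = tendsto_integral_dominated[OF assms(2) int integrable_exp_bound[OF \<sigma>] le conv]
  show "has_laplace a s (laplace s a)"
    by (rule has_laplace_laplace) (rule dominated)
  show "((\<lambda>x. laplace s (profile_deriv l 3 w x)) \<longlongrightarrow> laplace s a) (at l0 within S)"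
    unfolding laplace_def by (rule dominated)
qed

text \<open>The force balance expresses \<open>u0\<close> through functions already known to be
  transformable, so the existence of its transform is derived from the trajectory.\<close>

lemma laplace_interface:
  obtains A B U where
    "((\<lambda>x. laplace s (profile_deriv l 3 w x)) \<longlongrightarrow> A) (at_left l0)"
    "((\<lambda>x. laplace s (profile_deriv l 3 w x)) \<longlongrightarrow> B) (at_right l0)"
    "has_laplace u0 s U"
    "(of_real m * s^2 + of_real \<kappa>) * laplace s (w l0) = of_real (E * I) * A - of_real (E * I) * B + U"
proof -
  have "\<forall>t\<ge>0. \<exists>a b. ((\<lambda>x. profile_deriv l 3 w x t) \<longlongrightarrow> a) (at_left l0) \<and>
      ((\<lambda>x. profile_deriv l 3 w x t) \<longlongrightarrow> b) (at_right l0) \<and>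
      m * deriv_t (deriv_t (w l0)) t + \<kappa> * w l0 t = E * I * a - E * I * b + u0 t"
    using trajectory unfolding beam_trajectory_def profile_deriv_def by (simp add: eval_nat_numeral)
  then obtain a b where
    lim: "\<And>t. t \<ge> 0 \<Longrightarrow> ((\<lambda>x. profile_deriv l 3 w x t) \<longlongrightarrow> a t) (at_left l0)"
      "\<And>t. t \<ge> 0 \<Longrightarrow> ((\<lambda>x. profile_deriv l 3 w x t) \<longlongrightarrow> b t) (at_right l0)"
    and u0: "\<And>t. t \<ge> 0 \<Longrightarrow> m * deriv_t (deriv_t (w l0)) t + \<kappa> * w l0 t = E * I * a t - E * I * b t + u0 t"
    by metis
  \<comment> \<open>The one-sided filters are rewritten as filters within subsets of the beam, where
    the exponential bounds are available.\<close>
  have at: "at l0 within {0..l0} = at_left l0" "at l0 within {l0..l} = at_right l0"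
    using l0 by (simp_all add: at_within_Icc_at_left at_within_Icc_at_right)
  have "l0 islimpt {0..l0}" "l0 islimpt {l0..l}"
    using l0 by (simp_all add: islimpt_Icc)
  then have A: "has_laplace a s (laplace s a)"
      "((\<lambda>x. laplace s (profile_deriv l 3 w x)) \<longlongrightarrow> laplace s a) (at_left l0)"
    and B: "has_laplace b s (laplace s b)"
      "((\<lambda>x. laplace s (profile_deriv l 3 w x)) \<longlongrightarrow> laplace s b) (at_right l0)"
    using laplace_one_sided_limit[of "{0..l0}" a] laplace_one_sided_limit[of "{l0..l}" b] l0 lim
    unfolding at by auto
  \<comment> \<open>This is the transformed force balance solved for the input.\<close>
  define U where "U = of_real m * (s^2 * laplace s (w l0)) + of_real \<kappa> * laplace s (w l0)
    + (of_real (- E * I) * laplace s a + of_real (E * I) * laplace s b)"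
  have "has_laplace (\<lambda>t. m * deriv_t (deriv_t (w l0)) t + \<kappa> * w l0 t + ((- E * I) * a t + (E * I) * b t)) s U"
    unfolding U_def using l0 by (intro has_laplace_add has_laplace_cmult laplace_t A B) auto
  then have "has_laplace u0 s U"
    by (rule has_laplace_eq) (use u0 in auto)
  then show thesis
    by (rule that[OF A(2) B(2)]) (simp add: U_def algebra_simps)
qed

lemma transformed_problem_laplace:
  obtains U where "has_laplace u0 s U" "transformed_problem l l0 E I \<rho> m \<kappa> d s U (\<lambda>x. laplace s (w x))"
proof -
  obtain A B U where AB:
    "((\<lambda>x. laplace s (profile_deriv l 3 w x)) \<longlongrightarrow> A) (at_left l0)"
    "((\<lambda>x. laplace s (profile_deriv l 3 w x)) \<longlongrightarrow> B) (at_right l0)"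
    and U: "has_laplace u0 s U"
      "(of_real m * s^2 + of_real \<kappa>) * laplace s (w l0) = of_real (E * I) * A - of_real (E * I) * B + U"
    using laplace_interface .
  have D3: "((deriv_x l ^^ 3) (\<lambda>x. laplace s (w x)) \<longlongrightarrow> A) (at_left l0)"
  proof (rule Lim_transform_eventually[OF AB(1)])
    show "\<forall>\<^sub>F x in at_left l0. laplace s (profile_deriv l 3 w x) = (deriv_x l ^^ 3) (\<lambda>x. laplace s (w x)) x"
      using eventually_at_left_real[OF l0(1)]
      by eventually_elim (use l0 in \<open>subst deriv_x_laplace(1); simp\<close>)
  qed
  have D3': "((deriv_x l ^^ 3) (\<lambda>x. laplace s (w x)) \<longlongrightarrow> B) (at_right l0)"
  proof (rule Lim_transform_eventually[OF AB(2)])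
    show "\<forall>\<^sub>F x in at_right l0. laplace s (profile_deriv l 3 w x) = (deriv_x l ^^ 3) (\<lambda>x. laplace s (w x)) x"
      using eventually_at_right_real[OF l0(2)]
      by eventually_elim (use l0 in \<open>subst deriv_x_laplace(1); simp\<close>)
  qed
  have "beam_profile l l0 (\<lambda>x. laplace s (w x))"
    unfolding beam_profile_def
  proof (intro conjI)
    show "differentiable_x l 2 {0..l} (\<lambda>x. laplace s (w x))"
      by (rule differentiable_xI[where F = "\<lambda>k x. laplace s (profile_deriv l k w x)",
            OF l_pos openin_Icc_pieces(1) laplace_w_C2(2)]) auto
    show "differentiable_x l 4 ({0..l} - {l0}) (\<lambda>x. laplace s (w x))"
      by (rule differentiable_xI[where F = "\<lambda>k x. laplace s (profile_deriv l k w x)",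
            OF l_pos openin_Icc_pieces(2) laplace_w(2)]) auto
    show "continuous_on {0..l} ((deriv_x l ^^ 2) (\<lambda>x. laplace s (w x)))"
      using continuous_laplace_bending deriv_x_laplace(2)[of _ 2] by (subst continuous_on_cong[OF refl]) auto
  qed
  moreover have "hinged l (\<lambda>x. laplace s (w x))"
  proof -
    have zero: "laplace s f = 0" if "\<And>t. t \<ge> 0 \<Longrightarrow> f t = 0" for f
      using has_laplace_eq[OF has_laplace_0, of f] that
      by (simp add: has_laplace_iff laplace_def integral_unique)
    have "(deriv_x l ^^ 2) (\<lambda>x. laplace s (w x)) x = laplace s (profile_deriv l 2 w x)" if "x \<in> {0..l}" for x
      using deriv_x_laplace(2)[OF that] by simp
    then show ?thesis
      unfolding hinged_def using l0 hinged_ends by (auto simp: profile_deriv_def hinged_def intro!: zero)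
  qed
  moreover have "(of_real (E * I) + of_real (\<rho> * d) * s) * (deriv_x l ^^ 4) (\<lambda>x. laplace s (w x)) x
      + of_real \<rho> * s^2 * laplace s (w x) = 0" if "x \<in> {0..l} - {l0}" for x
    using laplace_pde[OF that] deriv_x_laplace(1)[OF that order_refl] by simp
  ultimately have "transformed_problem l l0 E I \<rho> m \<kappa> d s U (\<lambda>x. laplace s (w x))"
    unfolding transformed_problem_def using D3 D3' U(2) by blast
  with U(1) show thesis
    by (rule that)
qed

lemma has_laplace_sensor_output:
  assumes "l1 \<in> {0..l}"
  shows "has_laplace (sensor_output l l1 w) s ((deriv_x l ^^ 2) (\<lambda>x. laplace s (w x)) l1)"
proof -
  have "sensor_output l l1 w = profile_deriv l 2 w l1"
    by (simp add: fun_eq_iff sensor_output_def profile_deriv_def)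
  then show ?thesis
    using has_laplace_laplace[OF laplace_w_C2(1)[OF assms]] deriv_x_laplace(2)[OF assms] by simp
qed

end

section \<open>The transfer function\<close>

theorem lemma2:
  fixes l l0 l1 E I \<rho> m \<kappa> d :: real
    and s \<alpha> r \<gamma> \<beta> :: complex
    and M :: "complex^4^4"
  assumes "l > 0" and "0 < l0" and "l0 < l" and "0 \<le> l1" and "l1 \<le> l"
    and "E > 0" and "I > 0" and "\<rho> > 0" and "m > 0" and "\<kappa> > 0" and "d \<ge> 0"
    and "l1 \<le> l0"
    and "s \<noteq> 0" and "of_real (E * I) + of_real (\<rho> * d) * s \<noteq> 0"
    and "\<alpha>^4 = of_real \<rho> / (of_real (E * I) + of_real (\<rho> * d) * s)"
    and "r^2 = 2 * s" and "\<gamma> = \<alpha> * r / 2"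
    and "\<beta> = (s^2 * of_real m + of_real \<kappa>) / of_real (E * I)"
    and "M = shaker_matrix l l0 \<gamma> \<beta>" and "invertible M"
  shows "is_transfer_function_at l l0 l1 E I \<rho> m \<kappa> d s
    (1 / of_real (E * I) *
      (- 4 * \<gamma>^4 * z4 \<gamma> l1 * matrix_inv M $ 1 $ 4 + z2 \<gamma> l1 * matrix_inv M $ 2 $ 4))"
proof -
  \<comment> \<open>Only \<open>\<alpha>^4\<close> and \<open>r^4\<close> enter
    \<open>\<gamma>^4\<close>, so no branch of either root has to be fixed.\<close>
  have "r^4 = (r^2)^2"
    by simp
  then have "r^4 = 4 * s^2"
    unfolding \<open>r^2 = 2 * s\<close> by (simp add: power_mult_distrib)
  then have "4 * \<gamma>^4 = \<alpha>^4 * s^2"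
    unfolding \<open>\<gamma> = \<alpha> * r / 2\<close> by (simp add: power_mult_distrib power_divide)
  then have char: "4 * \<gamma>^4 * (of_real (E * I) + of_real (\<rho> * d) * s) = of_real \<rho> * s^2"
    unfolding assms(15) using assms(14) by (simp del: of_real_mult)
  \<comment> \<open>If \<open>\<gamma>\<close> were zero, the left side of \<open>char\<close> would
    vanish, whereas \<open>of_real \<rho> * s^2\<close> does not.\<close>
  then have "\<gamma> \<noteq> 0"
    using \<open>s \<noteq> 0\<close> \<open>\<rho> > 0\<close> by (auto simp del: of_real_mult)
  then interpret shaker_beam l l0 E I \<rho> m \<kappa> d s \<gamma> \<beta>
    using assms char by unfold_locales auto
  let ?h = "1 / of_real (E * I) *
      (- 4 * \<gamma>^4 * z4 \<gamma> l1 * matrix_inv M $ 1 $ 4 + z2 \<gamma> l1 * matrix_inv M $ 2 $ 4)"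
  have gain: "(deriv_x l ^^ 2) W l1 = ?h * U" if "transformed_problem l l0 E I \<rho> m \<kappa> d s U W" for U W
    using transformed_problem_output[OF _ that, of l1] \<open>invertible M\<close> \<open>0 \<le> l1\<close> \<open>l1 \<le> l0\<close>
    unfolding \<open>M = shaker_matrix l l0 \<gamma> \<beta>\<close> by simp
  have "\<exists>U Y. has_laplace u0 s U \<and> has_laplace (sensor_output l l1 w) s Y \<and> Y = ?h * U"
    if w: "beam_trajectory l l0 E I \<rho> m \<kappa> d u0 w" "exponential_order_below l l0 s w" for u0 w
  proof -
    from w(2) obtain C \<sigma> where "\<sigma> < Re s"
      and "\<And>x t j. x \<in> {0..l} \<Longrightarrow> t \<ge> 0 \<Longrightarrow> j \<le> 2 \<Longrightarrow> \<bar>(deriv_t ^^ j) (w x) t\<bar> \<le> C * exp (\<sigma> * t)"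
      and "\<And>x t k. x \<in> {0..l} - {l0} \<Longrightarrow> t \<ge> 0 \<Longrightarrow> k \<le> 4 \<Longrightarrow> \<bar>profile_deriv l k w x t\<bar> \<le> C * exp (\<sigma> * t) \<and>
        \<bar>profile_deriv l k (\<lambda>x. deriv_t (w x)) x t\<bar> \<le> C * exp (\<sigma> * t)"
      unfolding exponential_order_below_def profile_deriv_def by metis
    then interpret transformable_trajectory l l0 E I \<rho> m \<kappa> d s u0 w C \<sigma>
      using assms w(1) by unfold_locales auto
    obtain U where "has_laplace u0 s U" "transformed_problem l l0 E I \<rho> m \<kappa> d s U (\<lambda>x. laplace s (w x))"
      using transformed_problem_laplace .
    \<comment> \<open>The transform of the trajectory is itself a solution of the transformed
      problem, so \<open>gain\<close> applies to it.\<close>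
    then show ?thesis
      using has_laplace_sensor_output[of l1] gain assms by fastforce
  qed
  moreover have "\<exists>W. transformed_problem l l0 E I \<rho> m \<kappa> d s U W" for U
    using transformed_problem_solvable assms by blast
  ultimately show ?thesis
    unfolding is_transfer_function_at_def using gain by blast
qed

end
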